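(* Let $(M,\rho)$ be a metric space and let $f:[c,d]\to M$ and $g:[a,b]\to[c,d]$ be absolutely continuous. Define $h(x)=md(f,g(x))\cdot g'(x)$ for $x\in[a,b]$, with the convention that $h(x)=0$ whenever $g'(x)=0$ (even if $md(f,g(x))$ does not exist); $h$ is defined almost everywhere. Then $f\circ g$ is absolutely continuous if and only if $h$ is Lebesgue integrable on $[a,b]$.
   Context: For $\varphi:[\alpha,\beta]\to(M,\rho)$, $md(\varphi,y)=\lim_{t\to0,\ y+t\in[\alpha,\beta]}\rho(\varphi(y+t),\varphi(y))/|t|$ when it exists. A map $\varphi:[\alpha,\beta]\to(M,\rho)$ (or into $\mathbb R$) is absolutely continuous if for every $\varepsilon>0$ there is $\delta>0$ such that for non-overlapping intervals $[a_i,b_i]\subset[\alpha,\beta]$ with $\sum_i(b_i-a_i)<\delta$ one has $\sum_i\rho(\varphi(b_i),\varphi(a_i))<\varepsilon$. *)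

theory Defs
  imports "HOL-Analysis.Analysis"
begin

definition abs_cont_metric :: "(real \<Rightarrow> 'm::metric_space) \<Rightarrow> real \<Rightarrow> real \<Rightarrow> bool" where
  "abs_cont_metric \<phi> \<alpha> \<beta> \<longleftrightarrow>
     (\<forall>\<epsilon>>0. \<exists>\<delta>>0. \<forall>(n::nat) (a::nat \<Rightarrow> real) (b::nat \<Rightarrow> real).
        (\<forall>i<n. \<alpha> \<le> a i \<and> a i \<le> b i \<and> b i \<le> \<beta>) \<and>
        (\<forall>i<n. \<forall>j<n. i \<noteq> j \<longrightarrow> b i \<le> a j \<or> b j \<le> a i) \<and>
        (\<Sum>i<n. b i - a i) < \<delta>
        \<longrightarrow> (\<Sum>i<n. dist (\<phi> (b i)) (\<phi> (a i))) < \<epsilon>)"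

definition has_metric_derivative :: "(real \<Rightarrow> 'm::metric_space) \<Rightarrow> real set \<Rightarrow> real \<Rightarrow> real \<Rightarrow> bool" where
  "has_metric_derivative \<phi> S y L \<longleftrightarrow>
     ((\<lambda>t. dist (\<phi> (y + t)) (\<phi> y) / \<bar>t\<bar>) \<longlongrightarrow> L) (at 0 within {t. y + t \<in> S})"

text \<open>The value v is the value h(x) = md(f, g x) * g'(x), with h(x) = 0 when g'(x) = 0
  (h(x) is defined at x iff such a v exists).\<close>
definition h_value_at ::
  "(real \<Rightarrow> 'm::metric_space) \<Rightarrow> (real \<Rightarrow> real) \<Rightarrow> real \<Rightarrow> real \<Rightarrow> real \<Rightarrow> real \<Rightarrow> real \<Rightarrow> real \<Rightarrow> bool" where
  "h_value_at f g a b c d x v \<longleftrightarrow>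
     (\<exists>D. (g has_real_derivative D) (at x within {a..b}) \<and>
          (if D = 0 then v = 0 else (\<exists>L. has_metric_derivative f {c..d} (g x) L \<and> v = L * D)))"

end

theory Submission
  imports Defs
begin

text \<open>The variation \<open>v\<close> of an absolutely continuous map \<open>f\<close> is the integral of some \<open>\<phi>\<close>
  (Radon-Nikodym). Away from finitely many points, \<open>v t - v s - dist (f t) (f s)\<close> has a small sum over
  nonoverlapping intervals; Henstock's lemma and a Vitali covering then give \<open>md f = \<phi>\<close> almost
  everywhere. In the same way an absolutely continuous real \<open>g\<close>, a difference of monotone ones, is almost
  everywhere differentiable with integrable derivative. Since \<open>g\<close> pulls null sets back to null sets where
  \<open>g' \<noteq> 0\<close>, \<open>h\<close> is defined almost everywhere, and \<open>\<bar>h\<bar>\<close> is the metric derivative of \<open>f \<circ> g\<close>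
  wherever \<open>g' \<noteq> 0\<close>. So if \<open>f \<circ> g\<close> is absolutely continuous, \<open>h = sgn g' * md (f \<circ> g)\<close> is integrable.

  Conversely, put \<open>u = dist ((f \<circ> g) _) ((f \<circ> g) s)\<close>. The interval from \<open>0\<close> to \<open>u t\<close> is covered by
  \<open>u ` {s..t}\<close>. The points where \<open>g\<close> is not differentiable, where \<open>g' = 0\<close>, or where \<open>md (f \<circ> g) = \<bar>h\<bar>\<close> fails
  are mapped by \<open>g\<close>, and then by the distance function, to a null set (Sard, and Lusin's condition N);
  on the others \<open>u\<close> grows at rate at most \<open>\<bar>h\<bar>\<close>, so the image has measure at most \<open>2 * \<integral>\<bar>h\<bar>\<close> by
  Henstock's lemma. Hence \<open>dist ((f \<circ> g) t) ((f \<circ> g) s)\<close> is at most twice the integral of \<open>\<bar>h\<bar>\<close> over \<open>{s..t}\<close>.\<close>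

section \<open>Finite families of nonoverlapping intervals\<close>

text \<open>Sets of end point pairs are used rather than indexed sequences, so that unions, subsets
  and images of families can be formed. Degenerate intervals are excluded: nonoverlapping members
  are then linearly ordered on the line, and no interval can stand beside itself.\<close>

definition interval_family :: "real \<Rightarrow> real \<Rightarrow> (real \<times> real) set \<Rightarrow> bool" where
  "interval_family a b F \<longleftrightarrow> finite F \<and> (\<forall>(s, t)\<in>F. a \<le> s \<and> s < t \<and> t \<le> b) \<and>
     (\<forall>p\<in>F. \<forall>q\<in>F. p \<noteq> q \<longrightarrow> snd p \<le> fst q \<or> snd q \<le> fst p)"

lemma interval_family_finite: "interval_family a b F \<Longrightarrow> finite F"
  by (simp add: interval_family_def)

lemma interval_family_bounds:
  "interval_family a b F \<Longrightarrow> p \<in> F \<Longrightarrow> a \<le> fst p \<and> fst p < snd p \<and> snd p \<le> b"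
  by (auto simp: interval_family_def)

lemma interval_family_disjoint:
  "interval_family a b F \<Longrightarrow> p \<in> F \<Longrightarrow> q \<in> F \<Longrightarrow> p \<noteq> q \<Longrightarrow> snd p \<le> fst q \<or> snd q \<le> fst p"
  by (simp add: interval_family_def)

lemma interval_familyI:
  assumes "finite F" "\<And>p. p \<in> F \<Longrightarrow> a \<le> fst p \<and> fst p < snd p \<and> snd p \<le> b"
    "\<And>p q. p \<in> F \<Longrightarrow> q \<in> F \<Longrightarrow> p \<noteq> q \<Longrightarrow> snd p \<le> fst q \<or> snd q \<le> fst p"
  shows "interval_family a b F"
  using assms by (auto simp: interval_family_def)

text \<open>Induction on the number of intervals: the rightmost one is split off, the others lie to
  its left, and the gap that remains on the right contributes a nonnegative amount.\<close>

lemma superadditive_sum_le: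
  fixes G :: "real \<Rightarrow> real \<Rightarrow> real"
  assumes "interval_family x y F" "x \<le> y"
    and nonneg: "\<And>s t. x \<le> s \<Longrightarrow> s \<le> t \<Longrightarrow> t \<le> y \<Longrightarrow> 0 \<le> G s t"
    and super: "\<And>r s t. x \<le> r \<Longrightarrow> r \<le> s \<Longrightarrow> s \<le> t \<Longrightarrow> t \<le> y \<Longrightarrow> G r s + G s t \<le> G r t"
  shows "(\<Sum>p\<in>F. G (fst p) (snd p)) \<le> G x y"
  using assms
proof (induction "card F" arbitrary: F y)
  case 0
  then show ?case using interval_family_finite[OF 0(2)] by auto
next
  case (Suc n)
  have fin: "finite F" using interval_family_finite Suc.prems(1) by blast
  then have "F \<noteq> {}" using Suc.hyps(2) by auto
  \<comment> \<open>Twice the midpoint is maximised; among nonoverlapping nondegenerate intervals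
    this picks the rightmost one.\<close>
  then obtain p where p: "p \<in> F" and pmax: "\<And>q. q \<in> F \<Longrightarrow> fst q + snd q \<le> fst p + snd p"
    using fin Max_in[of "(\<lambda>p. fst p + snd p) ` F"] Max_ge[of "(\<lambda>p. fst p + snd p) ` F"] by fastforce
  have bp: "x \<le> fst p" "fst p < snd p" "snd p \<le> y"
    using interval_family_bounds[OF Suc.prems(1) p] by auto
  have left: "snd q \<le> fst p" if "q \<in> F" "q \<noteq> p" for q
    using interval_family_disjoint[OF Suc.prems(1) p that(1)] that pmax[OF that(1)]
      interval_family_bounds[OF Suc.prems(1) that(1)] bp by auto
  have "interval_family x (fst p) (F - {p})"
    by (rule interval_familyI)
      (use fin left interval_family_bounds[OF Suc.prems(1)] interval_family_disjoint[OF Suc.prems(1)] in auto)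
  then have "(\<Sum>p\<in>F - {p}. G (fst p) (snd p)) \<le> G x (fst p)"
    using bp by (intro Suc.hyps(1)) (use Suc fin p in auto)
  then have "(\<Sum>p\<in>F. G (fst p) (snd p)) \<le> G x (fst p) + G (fst p) (snd p)"
    using sum.remove[OF fin p, of "\<lambda>p. G (fst p) (snd p)"] by linarith
  also have "\<dots> \<le> G x (snd p)" using bp Suc.prems(4) by auto
  also have "\<dots> \<le> G x (snd p) + G (snd p) y" using Suc.prems(3)[of "snd p" y] bp by auto
  also have "\<dots> \<le> G x y" using Suc.prems(4)[of x "snd p" y] bp by auto
  finally show ?case .
qed

lemma interval_family_length_le:
  assumes "interval_family x y F" "x \<le> y"
  shows "(\<Sum>p\<in>F. snd p - fst p) \<le> y - x"
  using superadditive_sum_le[OF assms, of "\<lambda>s t. t - s"] by simp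

section \<open>Absolute continuity in terms of interval families\<close>

text \<open>One direction enumerates a finite family; the other discards the degenerate intervals of
  a sequence, which contribute nothing to either sum.\<close>

lemma abs_cont_metric_iff:
  "abs_cont_metric \<phi> \<alpha> \<beta> \<longleftrightarrow>
     (\<forall>\<epsilon>>0. \<exists>\<delta>>0. \<forall>F. interval_family \<alpha> \<beta> F \<and> (\<Sum>p\<in>F. snd p - fst p) < \<delta> \<longrightarrow>
        (\<Sum>p\<in>F. dist (\<phi> (snd p)) (\<phi> (fst p))) < \<epsilon>)"  (is "?L = ?R")
proof
  assume L: ?L
  show ?R
  proof (intro allI impI)
    fix \<epsilon> :: real assume "\<epsilon> > 0"
    then obtain \<delta> where "\<delta> > 0" and \<delta>: "\<forall>(n::nat) (a::nat \<Rightarrow> real) (b::nat \<Rightarrow> real).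
        (\<forall>i<n. \<alpha> \<le> a i \<and> a i \<le> b i \<and> b i \<le> \<beta>) \<and>
        (\<forall>i<n. \<forall>j<n. i \<noteq> j \<longrightarrow> b i \<le> a j \<or> b j \<le> a i) \<and>
        (\<Sum>i<n. b i - a i) < \<delta> \<longrightarrow> (\<Sum>i<n. dist (\<phi> (b i)) (\<phi> (a i))) < \<epsilon>"
      using L[unfolded abs_cont_metric_def] by blast
    have "(\<Sum>p\<in>F. dist (\<phi> (snd p)) (\<phi> (fst p))) < \<epsilon>"
      if F: "interval_family \<alpha> \<beta> F" and less: "(\<Sum>p\<in>F. snd p - fst p) < \<delta>" for F
    proof -
      obtain e where e: "bij_betw e {..<card F} F"
        using ex_bij_betw_nat_finite[OF interval_family_finite[OF F]] atLeast0LessThan by metis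
      have eF: "e i \<in> F" if "i < card F" for i using e that bij_betwE by blast
      have "(\<Sum>i<card F. dist (\<phi> (snd (e i))) (\<phi> (fst (e i)))) < \<epsilon>"
      proof (rule \<delta>[THEN spec, THEN spec, THEN spec, THEN mp], intro conjI allI impI)
        fix i j assume "i < card F" "j < card F" "i \<noteq> j"
        then show "snd (e i) \<le> fst (e j) \<or> snd (e j) \<le> fst (e i)"
          using e interval_family_disjoint[OF F, of "e i" "e j"] eF
          by (auto simp: bij_betw_def inj_on_def)
      next
        show "(\<Sum>i<card F. snd (e i) - fst (e i)) < \<delta>"
          using less sum.reindex_bij_betw[OF e, of "\<lambda>p. snd p - fst p"] by simp
      qed (use interval_family_bounds[OF F eF] in \<open>auto intro: less_imp_le\<close>)
      then show ?thesis
        using sum.reindex_bij_betw[OF e, of "\<lambda>p. dist (\<phi> (snd p)) (\<phi> (fst p))"] by simp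
    qed
    with \<open>\<delta> > 0\<close> show "\<exists>\<delta>>0. \<forall>F. interval_family \<alpha> \<beta> F \<and> (\<Sum>p\<in>F. snd p - fst p) < \<delta> \<longrightarrow>
        (\<Sum>p\<in>F. dist (\<phi> (snd p)) (\<phi> (fst p))) < \<epsilon>" by blast
  qed
next
  assume R: ?R
  show ?L
    unfolding abs_cont_metric_def
  proof (intro allI impI)
    fix \<epsilon> :: real assume "\<epsilon> > 0"
    then obtain \<delta> where "\<delta> > 0" and \<delta>: "\<And>F. interval_family \<alpha> \<beta> F \<Longrightarrow> (\<Sum>p\<in>F. snd p - fst p) < \<delta> \<Longrightarrow>
        (\<Sum>p\<in>F. dist (\<phi> (snd p)) (\<phi> (fst p))) < \<epsilon>"
      using R by meson
    have "(\<Sum>i<n. dist (\<phi> (b i)) (\<phi> (a i))) < \<epsilon>"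
      if ab: "\<forall>i<n. \<alpha> \<le> a i \<and> a i \<le> b i \<and> b i \<le> \<beta>"
        and dj: "\<forall>i<n. \<forall>j<n. i \<noteq> j \<longrightarrow> b i \<le> a j \<or> b j \<le> a i"
        and less: "(\<Sum>i<n. b i - a i) < \<delta>" for n :: nat and a b :: "nat \<Rightarrow> real"
    proof -
      \<comment> \<open>On \<open>I\<close> the map to end point pairs is injective: two indices
        with the same interval would give \<open>b i \<le> a i\<close>, against
        \<open>a i < b i\<close>.\<close>
      define I where "I = {i. i < n \<and> a i < b i}"
      have inj: "inj_on (\<lambda>i. (a i, b i)) I"
      proof (rule inj_onI)
        fix i j assume "i \<in> I" "j \<in> I" "(a i, b i) = (a j, b j)"
        then show "i = j" using dj[rule_format, of i j] by (auto simp: I_def)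
      qed
      let ?F = "(\<lambda>i. (a i, b i)) ` I"
      have eq: "(\<Sum>i<n. k i) = (\<Sum>i\<in>I. k i)" if "\<And>i. i < n \<Longrightarrow> a i = b i \<Longrightarrow> k i = 0" for k :: "nat \<Rightarrow> real"
        using that ab by (intro sum.mono_neutral_right) (force simp: I_def)+
      have "interval_family \<alpha> \<beta> ?F"
        
      proof (rule interval_familyI)
        fix p q assume "p \<in> ?F" "q \<in> ?F" "p \<noteq> q"
        then obtain i j where "i \<in> I" "p = (a i, b i)" "j \<in> I" "q = (a j, b j)" "i \<noteq> j" by auto
        then show "snd p \<le> fst q \<or> snd q \<le> fst p" using dj[rule_format, of i j] by (auto simp: I_def)
      qed (use ab in \<open>auto simp: I_def\<close>)
      moreover have "(\<Sum>p\<in>?F. snd p - fst p) < \<delta>"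
        using less eq[of "\<lambda>i. b i - a i"] by (simp add: sum.reindex[OF inj])
      ultimately have "(\<Sum>p\<in>?F. dist (\<phi> (snd p)) (\<phi> (fst p))) < \<epsilon>" by (rule \<delta>)
      then show ?thesis
        using eq[of "\<lambda>i. dist (\<phi> (b i)) (\<phi> (a i))"] by (simp add: sum.reindex[OF inj])
    qed
    with \<open>\<delta> > 0\<close> show "\<exists>\<delta>>0. \<forall>(n::nat) (a::nat \<Rightarrow> real) (b::nat \<Rightarrow> real).
        (\<forall>i<n. \<alpha> \<le> a i \<and> a i \<le> b i \<and> b i \<le> \<beta>) \<and>
        (\<forall>i<n. \<forall>j<n. i \<noteq> j \<longrightarrow> b i \<le> a j \<or> b j \<le> a i) \<and>
        (\<Sum>i<n. b i - a i) < \<delta> \<longrightarrow> (\<Sum>i<n. dist (\<phi> (b i)) (\<phi> (a i))) < \<epsilon>" by blast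
  qed
qed

lemma abs_cont_metricD:
  assumes "abs_cont_metric \<phi> \<alpha> \<beta>" "\<epsilon> > 0"
  obtains \<delta> where "\<delta> > 0" "\<And>F. interval_family \<alpha> \<beta> F \<Longrightarrow> (\<Sum>p\<in>F. snd p - fst p) < \<delta> \<Longrightarrow>
        (\<Sum>p\<in>F. dist (\<phi> (snd p)) (\<phi> (fst p))) < \<epsilon>"
  using assms unfolding abs_cont_metric_iff by meson

lemma abs_cont_metric_imp_uniform:
  assumes "abs_cont_metric \<phi> \<alpha> \<beta>" "\<epsilon> > 0"
  obtains \<delta> where "\<delta> > 0" "\<And>s t. s \<in> {\<alpha>..\<beta>} \<Longrightarrow> t \<in> {\<alpha>..\<beta>} \<Longrightarrow> \<bar>t - s\<bar> < \<delta> \<Longrightarrow> dist (\<phi> t) (\<phi> s) < \<epsilon>"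
proof -
  obtain \<delta> where "\<delta> > 0" and \<delta>: "\<And>F. interval_family \<alpha> \<beta> F \<Longrightarrow> (\<Sum>p\<in>F. snd p - fst p) < \<delta> \<Longrightarrow>
        (\<Sum>p\<in>F. dist (\<phi> (snd p)) (\<phi> (fst p))) < \<epsilon>"
    using abs_cont_metricD[OF assms] by blast
  have *: "dist (\<phi> t) (\<phi> s) < \<epsilon>" if "\<alpha> \<le> s" "s \<le> t" "t \<le> \<beta>" "t - s < \<delta>" for s t
    using \<delta>[of "{(s, t)}"] that \<open>\<epsilon> > 0\<close> by (cases "s = t") (auto simp: interval_family_def)
  show thesis
  proof
    fix s t assume "s \<in> {\<alpha>..\<beta>}" "t \<in> {\<alpha>..\<beta>}" "\<bar>t - s\<bar> < \<delta>"
    then show "dist (\<phi> t) (\<phi> s) < \<epsilon>"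
      using *[of s t] *[of t s] by (cases "s \<le> t") (auto simp: dist_commute)
  qed fact
qed

lemma abs_cont_metric_imp_continuous_on:
  assumes "abs_cont_metric \<phi> \<alpha> \<beta>"
  shows "continuous_on {\<alpha>..\<beta>} \<phi>"
  unfolding continuous_on_iff
proof (intro ballI allI impI)
  fix x \<epsilon> :: real assume "x \<in> {\<alpha>..\<beta>}" "\<epsilon> > 0"
  then show "\<exists>d>0. \<forall>x'\<in>{\<alpha>..\<beta>}. dist x' x < d \<longrightarrow> dist (\<phi> x') (\<phi> x) < \<epsilon>"
    using abs_cont_metric_imp_uniform[OF assms \<open>\<epsilon> > 0\<close>] by (metis dist_real_def)
qed

lemma abs_cont_metric_diff:
  fixes u v :: "real \<Rightarrow> real"
  assumes "abs_cont_metric u \<alpha> \<beta>" "abs_cont_metric v \<alpha> \<beta>"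
  shows "abs_cont_metric (\<lambda>x. u x - v x) \<alpha> \<beta>"
  unfolding abs_cont_metric_iff
proof (intro allI impI)
  fix \<epsilon> :: real assume "\<epsilon> > 0"
  then have e2: "\<epsilon>/2 > 0" by simp
  obtain \<delta>1 where "\<delta>1 > 0" and 1: "\<And>F. interval_family \<alpha> \<beta> F \<Longrightarrow> (\<Sum>p\<in>F. snd p - fst p) < \<delta>1 \<Longrightarrow>
        (\<Sum>p\<in>F. dist (u (snd p)) (u (fst p))) < \<epsilon>/2" using abs_cont_metricD[OF assms(1) e2] by blast
  obtain \<delta>2 where "\<delta>2 > 0" and 2: "\<And>F. interval_family \<alpha> \<beta> F \<Longrightarrow> (\<Sum>p\<in>F. snd p - fst p) < \<delta>2 \<Longrightarrow>
        (\<Sum>p\<in>F. dist (v (snd p)) (v (fst p))) < \<epsilon>/2" using abs_cont_metricD[OF assms(2) e2] by blast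
  have "(\<Sum>p\<in>F. dist (u (snd p) - v (snd p)) (u (fst p) - v (fst p))) < \<epsilon>"
    if F: "interval_family \<alpha> \<beta> F" "(\<Sum>p\<in>F. snd p - fst p) < min \<delta>1 \<delta>2" for F
  proof -
    have "(\<Sum>p\<in>F. dist (u (snd p) - v (snd p)) (u (fst p) - v (fst p)))
      \<le> (\<Sum>p\<in>F. dist (u (snd p)) (u (fst p)) + dist (v (snd p)) (v (fst p)))"
      by (intro sum_mono) (auto simp: dist_real_def)
    then show ?thesis using 1[of F] 2[of F] F by (simp add: sum.distrib)
  qed
  then show "\<exists>\<delta>>0. \<forall>F. interval_family \<alpha> \<beta> F \<and> (\<Sum>p\<in>F. snd p - fst p) < \<delta> \<longrightarrow>
        (\<Sum>p\<in>F. dist (u (snd p) - v (snd p)) (u (fst p) - v (fst p))) < \<epsilon>"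
    using \<open>\<delta>1 > 0\<close> \<open>\<delta>2 > 0\<close> by (intro exI[of _ "min \<delta>1 \<delta>2"]) auto
qed

text \<open>Serves to pass from \<open>f\<close> to the distance from a fixed point, a real function
  to which measure arguments apply.\<close>

lemma abs_cont_metric_dist_le:
  fixes f :: "real \<Rightarrow> 'm::metric_space" and w :: "real \<Rightarrow> 'n::metric_space"
  assumes "abs_cont_metric f \<alpha> \<beta>" "\<And>s t. \<alpha> \<le> s \<Longrightarrow> s \<le> t \<Longrightarrow> t \<le> \<beta> \<Longrightarrow> dist (w t) (w s) \<le> dist (f t) (f s)"
  shows "abs_cont_metric w \<alpha> \<beta>"
  unfolding abs_cont_metric_iff
proof (intro allI impI)
  fix \<epsilon> :: real assume "\<epsilon> > 0"
  obtain \<delta> where "\<delta> > 0" and \<delta>: "\<And>F. interval_family \<alpha> \<beta> F \<Longrightarrow> (\<Sum>p\<in>F. snd p - fst p) < \<delta> \<Longrightarrow>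
        (\<Sum>p\<in>F. dist (f (snd p)) (f (fst p))) < \<epsilon>" using abs_cont_metricD[OF assms(1) \<open>\<epsilon> > 0\<close>] by blast
  have "(\<Sum>p\<in>F. dist (w (snd p)) (w (fst p))) < \<epsilon>"
    if F: "interval_family \<alpha> \<beta> F" "(\<Sum>p\<in>F. snd p - fst p) < \<delta>" for F
  proof -
    have "(\<Sum>p\<in>F. dist (w (snd p)) (w (fst p))) \<le> (\<Sum>p\<in>F. dist (f (snd p)) (f (fst p)))"
      using interval_family_bounds[OF F(1)] by (intro sum_mono assms(2)) (force intro: less_imp_le)+
    with \<delta>[OF F] show ?thesis by simp
  qed
  then show "\<exists>\<delta>>0. \<forall>F. interval_family \<alpha> \<beta> F \<and> (\<Sum>p\<in>F. snd p - fst p) < \<delta> \<longrightarrow>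
        (\<Sum>p\<in>F. dist (w (snd p)) (w (fst p))) < \<epsilon>"
    using \<open>\<delta> > 0\<close> by auto
qed

section \<open>Refining and cutting families\<close>

lemma interval_family_mono:
  assumes "interval_family x y F" "a \<le> x" "y \<le> b"
  shows "interval_family a b F"
  unfolding interval_family_def using assms interval_family_finite[OF assms(1)]
    interval_family_bounds[OF assms(1)] interval_family_disjoint[OF assms(1)] by fastforce

text \<open>Joins families that were chosen separately inside each member of \<open>F\<close>.
  Nondegeneracy makes the families of different members disjoint as sets, so that the sum
  splits.\<close>

lemma interval_family_UN:
  assumes "interval_family a b F" "\<And>q. q \<in> F \<Longrightarrow> interval_family (fst q) (snd q) (H q)"
  shows "interval_family a b (\<Union>q\<in>F. H q)"
    and "(\<Sum>p\<in>(\<Union>q\<in>F. H q). k p) = (\<Sum>q\<in>F. \<Sum>p\<in>H q. k p)"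
proof -
  have b: "fst q \<le> fst p \<and> fst p < snd p \<and> snd p \<le> snd q" if "q \<in> F" "p \<in> H q" for p q
    using interval_family_bounds[OF assms(2)[OF that(1)] that(2)] .
  \<comment> \<open>The case \<open>p = p'\<close> with \<open>q \<noteq> q'\<close> is included on
    purpose: its conclusion contradicts nondegeneracy, which yields below that the sets
    \<open>H q\<close> are disjoint.\<close>
  have d: "snd p \<le> fst p' \<or> snd p' \<le> fst p"
    if "q \<in> F" "p \<in> H q" "q' \<in> F" "p' \<in> H q'" "p \<noteq> p' \<or> q \<noteq> q'" for p q p' q'
  proof (cases "q = q'")
    case True
    then show ?thesis using interval_family_disjoint[OF assms(2)[OF that(1)]] that by blast
  next
    case False
    then show ?thesis using interval_family_disjoint[OF assms(1) that(1,3)] b[OF that(1,2)] b[OF that(3,4)] by auto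
  qed
  show "interval_family a b (\<Union>q\<in>F. H q)"
  proof (rule interval_familyI)
    show "finite (\<Union>q\<in>F. H q)"
      using interval_family_finite assms by blast
    show "a \<le> fst p \<and> fst p < snd p \<and> snd p \<le> b" if p: "p \<in> (\<Union>q\<in>F. H q)" for p
      using p b interval_family_bounds[OF assms(1)] by fastforce
    show "snd p \<le> fst q \<or> snd q \<le> fst p"
      if "p \<in> (\<Union>q\<in>F. H q)" "q \<in> (\<Union>q\<in>F. H q)" "p \<noteq> q" for p q
      using that d by blast
  qed
  show "(\<Sum>p\<in>(\<Union>q\<in>F. H q). k p) = (\<Sum>q\<in>F. \<Sum>p\<in>H q. k p)"
  proof (rule sum.UNION_disjoint)
    show "finite F" "\<forall>i\<in>F. finite (H i)" using interval_family_finite assms by blast+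
    show "\<forall>i\<in>F. \<forall>j\<in>F. i \<noteq> j \<longrightarrow> H i \<inter> H j = {}"
      using d b by (metis disjoint_iff leD)
  qed
qed

definition family_sum :: "(real \<Rightarrow> 'm::metric_space) \<Rightarrow> (real \<times> real) set \<Rightarrow> real" where
  "family_sum f F = (\<Sum>p\<in>F. dist (f (snd p)) (f (fst p)))"

text \<open>Every interval is cut at \<open>y\<close>. One that contains \<open>y\<close> in its
  interior leaves a piece on each side, and the triangle inequality through \<open>f y\<close> shows
  that the sum does not drop.\<close>

lemma interval_family_split:
  assumes F: "interval_family x z F" and "x \<le> y" "y \<le> z"
  obtains F1 F2 where "interval_family x y F1" "interval_family y z F2"
    "family_sum f F \<le> family_sum f F1 + family_sum f F2"
proof
  let ?A = "{p\<in>F. fst p < y}" and ?B = "{p\<in>F. y < snd p}"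
  let ?a = "\<lambda>p::real\<times>real. (fst p, min (snd p) y)" and ?b = "\<lambda>p::real\<times>real. (max (fst p) y, snd p)"
  let ?F1 = "?a ` ?A" and ?F2 = "?b ` ?B"
  note fin = interval_family_finite[OF F] and bd = interval_family_bounds[OF F]
    and dj = interval_family_disjoint[OF F]
  show "interval_family x y ?F1"
  proof (rule interval_familyI)
    fix p q assume "p \<in> ?F1" "q \<in> ?F1" "p \<noteq> q"
    then obtain p' q' where "p' \<in> F" "q' \<in> F" "p = ?a p'" "q = ?a q'" "p' \<noteq> q'" by auto
    then show "snd p \<le> fst q \<or> snd q \<le> fst p" using dj[of p' q'] by auto
  qed (use fin bd in auto)
  show "interval_family y z ?F2"
  proof (rule interval_familyI)
    fix p q assume "p \<in> ?F2" "q \<in> ?F2" "p \<noteq> q"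
    then obtain p' q' where "p' \<in> F" "q' \<in> F" "p = ?b p'" "q = ?b q'" "p' \<noteq> q'" by auto
    then show "snd p \<le> fst q \<or> snd q \<le> fst p" using dj[of p' q'] by auto
  qed (use fin bd in auto)
  \<comment> \<open>Cutting keeps the left end points here and the right end points in
    \<open>injB\<close>; two different nonoverlapping intervals share neither.\<close>
  have injA: "inj_on ?a ?A"
  proof (rule inj_onI)
    fix p q assume "p \<in> ?A" "q \<in> ?A" "?a p = ?a q"
    then show "p = q" using dj[of p q] bd[of p] bd[of q] by auto
  qed
  have injB: "inj_on ?b ?B"
  proof (rule inj_onI)
    fix p q assume "p \<in> ?B" "q \<in> ?B" "?b p = ?b q"
    then show "p = q" using dj[of p q] bd[of p] bd[of q] by auto
  qed
  let ?ka = "\<lambda>p. dist (f (min (snd p) y)) (f (fst p))" and ?kb = "\<lambda>p. dist (f (snd p)) (f (max (fst p) y))"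
  have "family_sum f F \<le> (\<Sum>p\<in>F. (if fst p < y then ?ka p else 0) + (if y < snd p then ?kb p else 0))"
    unfolding family_sum_def
  proof (rule sum_mono)
    fix p assume "p \<in> F"
    then show "dist (f (snd p)) (f (fst p)) \<le> (if fst p < y then ?ka p else 0) + (if y < snd p then ?kb p else 0)"
      using bd[of p] dist_triangle[of "f (snd p)" "f (fst p)" "f y"]
      by (auto simp: min_def max_def)
  qed
  also have "\<dots> = (\<Sum>p\<in>?A. ?ka p) + (\<Sum>p\<in>?B. ?kb p)"
    by (simp add: sum.distrib sum.inter_filter fin)
  also have "\<dots> = family_sum f ?F1 + family_sum f ?F2"
    unfolding family_sum_def sum.reindex[OF injA] sum.reindex[OF injB] by simp
  finally show "family_sum f F \<le> family_sum f ?F1 + family_sum f ?F2" .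
qed

section \<open>The variation of an absolutely continuous map\<close>

text \<open>This is the usual total variation: gaps between the intervals of a family can be filled
  without lowering the sum. The real supremum is meaningful only once the sums are known to be
  bounded.\<close>

definition variation :: "(real \<Rightarrow> 'm::metric_space) \<Rightarrow> real \<Rightarrow> real \<Rightarrow> real" where
  "variation f x y = (SUP F\<in>{F. interval_family x y F}. family_sum f F)"

context
  fixes f :: "real \<Rightarrow> 'm::metric_space" and a b :: real
  assumes ac: "abs_cont_metric f a b"
begin

text \<open>With \<open>\<delta>\<close> belonging to the tolerance 1, a stretch shorter than
  \<open>\<delta>\<close> carries sums of at most 1. Finitely many such stretches make up
  \<open>{x..y}\<close>, so cutting and induction on their number give a bound.\<close>

lemma family_sum_bounded:
  assumes "a \<le> x" "x \<le> y" "y \<le> b"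
  obtains M where "\<And>F. interval_family x y F \<Longrightarrow> family_sum f F \<le> M"
proof -
  obtain \<delta> where "\<delta> > 0" and \<delta>: "\<And>F. interval_family a b F \<Longrightarrow> (\<Sum>p\<in>F. snd p - fst p) < \<delta> \<Longrightarrow>
        (\<Sum>p\<in>F. dist (f (snd p)) (f (fst p))) < 1"
    using abs_cont_metricD[OF ac zero_less_one] by blast
  have short: "family_sum f F \<le> 1" if F: "interval_family x y F" and "a \<le> x" "x \<le> y" "y \<le> b" "y - x < \<delta>" for F x y
  proof -
    have "interval_family a b F"
      by (rule interval_family_mono[OF F]) (use that in auto)
    moreover have "(\<Sum>p\<in>F. snd p - fst p) < \<delta>"
      using interval_family_length_le[OF F \<open>x \<le> y\<close>] that by linarith
    ultimately show ?thesis using \<delta>[of F] by (simp add: family_sum_def)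
  qed
  have "\<exists>M. \<forall>F. interval_family x y F \<longrightarrow> family_sum f F \<le> M"
    if "a \<le> x" "x \<le> y" "y \<le> b" "y - x \<le> real k * (\<delta>/2)" for k y
    using that
  proof (induction k arbitrary: y)
    case 0
    then show ?case using short[of x y] \<open>\<delta> > 0\<close> by (intro exI[of _ 1]) auto
  next
    case (Suc k)
    \<comment> \<open>At most \<open>\<delta>/2\<close> is cut off on the right, half of
      \<open>\<delta>\<close> because the length has to stay strictly below it; \<open>max\<close>
      covers the case that less than this is left.\<close>
    define y' where "y' = max x (y - \<delta>/2)"
    have y': "x \<le> y'" "y' \<le> y" "y - y' < \<delta>" "y' - x \<le> real k * (\<delta>/2)"
      using Suc.prems \<open>\<delta> > 0\<close> by (auto simp: y'_def algebra_simps max_def)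
    then obtain M where M: "\<And>F. interval_family x y' F \<Longrightarrow> family_sum f F \<le> M"
      using Suc.IH[of y'] Suc.prems by auto
    have "family_sum f F \<le> M + 1" if F: "interval_family x y F" for F
    proof -
      obtain F1 F2 where "interval_family x y' F1" "interval_family y' y F2"
          "family_sum f F \<le> family_sum f F1 + family_sum f F2"
        using interval_family_split[OF F y'(1,2)] by blast
      then show ?thesis using M[of F1] short[of y' y F2] y' Suc.prems by auto
    qed
    then show ?case by blast
  qed
  moreover obtain k :: nat where "(y - x) / (\<delta>/2) \<le> real k" using real_arch_simple by blast
  ultimately show thesis using that assms \<open>\<delta> > 0\<close> by (metis divide_le_eq half_gt_zero)
qed

lemma family_sum_le_variation:
  assumes "a \<le> x" "x \<le> y" "y \<le> b" "interval_family x y F"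
  shows "family_sum f F \<le> variation f x y"
proof -
  obtain M where "\<And>F. interval_family x y F \<Longrightarrow> family_sum f F \<le> M"
    using family_sum_bounded[OF assms(1-3)] by blast
  then show ?thesis unfolding variation_def
    by (intro cSUP_upper bdd_aboveI2[of _ _ M]) (use assms in auto)
qed

lemma variation_approx:
  assumes "a \<le> x" "x \<le> y" "y \<le> b" "e > 0"
  obtains F where "interval_family x y F" "variation f x y < family_sum f F + e"
proof -
  have ne: "{F. interval_family x y F} \<noteq> {}" by (auto simp: interval_family_def)
  have bdd: "bdd_above (family_sum f ` {F. interval_family x y F})"
    by (rule bdd_aboveI2[of _ _ "variation f x y"]) (use family_sum_le_variation[OF assms(1-3)] in auto)
  have "variation f x y - e < variation f x y" using assms by simp
  then obtain F where "interval_family x y F" "variation f x y - e < family_sum f F"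
    unfolding variation_def less_cSUP_iff[OF ne bdd] by auto
  then show thesis using that by force
qed

lemma dist_le_variation:
  assumes "a \<le> x" "x \<le> y" "y \<le> b"
  shows "dist (f y) (f x) \<le> variation f x y"
  using family_sum_le_variation[OF assms, of "{}"] family_sum_le_variation[OF assms, of "{(x, y)}"] assms
  by (cases "x = y") (auto simp: family_sum_def interval_family_def)

lemma variation_nonneg:
  assumes "a \<le> x" "x \<le> y" "y \<le> b"
  shows "0 \<le> variation f x y"
  using dist_le_variation[OF assms] zero_le_dist order_trans by blast

text \<open>Near-optimal families inside the members of \<open>F\<close> are joined. Sums of
  variations thus reduce to a distance sum over one family of no greater total length, to which the
  absolute continuity of \<open>f\<close> applies.\<close>

lemma variation_sum_approx:
  assumes F: "interval_family x y F" and xy: "a \<le> x" "y \<le> b" and "e > 0"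
  obtains K where "interval_family x y K" "(\<Sum>q\<in>F. variation f (fst q) (snd q)) \<le> family_sum f K + e"
    "(\<Sum>p\<in>K. snd p - fst p) \<le> (\<Sum>q\<in>F. snd q - fst q)"
proof -
  \<comment> \<open>Each member of \<open>F\<close> may lose \<open>e'\<close>; the added 1 keeps
    the divisor positive for empty \<open>F\<close>.\<close>
  define e' where "e' = e / (real (card F) + 1)"
  have "e' > 0" using \<open>e > 0\<close> by (simp add: e'_def)
  note bd = interval_family_bounds[OF F]
  have "\<exists>H. interval_family (fst q) (snd q) H \<and> variation f (fst q) (snd q) < family_sum f H + e'" if "q \<in> F" for q
  proof -
    have "a \<le> fst q" "fst q \<le> snd q" "snd q \<le> b" using bd[OF that] xy by auto
    from variation_approx[OF this \<open>e' > 0\<close>] show ?thesis by blast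
  qed
  then obtain H where H: "\<And>q. q \<in> F \<Longrightarrow> interval_family (fst q) (snd q) (H q)"
    and less: "\<And>q. q \<in> F \<Longrightarrow> variation f (fst q) (snd q) < family_sum f (H q) + e'" by metis
  show thesis
  proof (rule that)
    show "interval_family x y (\<Union>q\<in>F. H q)" by (rule interval_family_UN(1)[OF F H])
    have "(\<Sum>q\<in>F. variation f (fst q) (snd q)) \<le> (\<Sum>q\<in>F. family_sum f (H q) + e')"
      by (intro sum_mono) (use less in force)
    also have "\<dots> = family_sum f (\<Union>q\<in>F. H q) + card F * e'"
      using interval_family_UN(2)[OF F H, of "\<lambda>p. dist (f (snd p)) (f (fst p))"]
      by (simp add: sum.distrib family_sum_def)
    also have "card F * e' \<le> e" using \<open>e > 0\<close> by (simp add: e'_def field_simps)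
    finally show "(\<Sum>q\<in>F. variation f (fst q) (snd q)) \<le> family_sum f (\<Union>q\<in>F. H q) + e" by simp
    show "(\<Sum>p\<in>(\<Union>q\<in>F. H q). snd p - fst p) \<le> (\<Sum>q\<in>F. snd q - fst q)"
      using interval_family_UN(2)[OF F H, of "\<lambda>p. snd p - fst p"]
        sum_mono[of F "\<lambda>q. \<Sum>p\<in>H q. snd p - fst p" "\<lambda>q. snd q - fst q"]
        interval_family_length_le[OF H] bd by (force intro: less_imp_le)
  qed
qed

text \<open>Subadditivity comes from cutting a near-optimal family at \<open>y\<close>,
  superadditivity from joining near-optimal families on the two sides.\<close>

lemma variation_add:
  assumes "a \<le> x" "x \<le> y" "y \<le> z" "z \<le> b"
  shows "variation f x z = variation f x y + variation f y z"
proof (rule antisym)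
  have "variation f x z \<le> variation f x y + variation f y z + e" if e: "e > 0" for e
  proof -
    obtain F where F: "interval_family x z F" "variation f x z < family_sum f F + e"
      using variation_approx[OF assms(1) order_trans[OF assms(2,3)] assms(4) e] by blast
    obtain F1 F2 where "interval_family x y F1" "interval_family y z F2"
        "family_sum f F \<le> family_sum f F1 + family_sum f F2"
      using interval_family_split[OF F(1) assms(2,3)] by blast
    then show ?thesis using F(2) family_sum_le_variation[of x y F1] family_sum_le_variation[of y z F2] assms by auto
  qed
  then show "variation f x z \<le> variation f x y + variation f y z"
    by (rule field_le_epsilon)
next
  \<comment> \<open>For \<open>x = y\<close> or \<open>y = z\<close> the two pairs used below do not
    form a family, so these cases rest on the variation over a single point being zero.\<close>
  have nil: "variation f u u = 0" for u
  proof -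
    have "F = {}" if "interval_family u u F" for F
      using interval_family_bounds[OF that] by fastforce
    then have "{F. interval_family u u F} = {{}}" by (auto simp: interval_family_def)
    then show ?thesis by (simp add: variation_def family_sum_def)
  qed
  show "variation f x y + variation f y z \<le> variation f x z"
  proof (cases "x < y \<and> y < z")
    case True
    have "variation f x y + variation f y z \<le> variation f x z + e" if e: "e > 0" for e
    proof -
      have F: "interval_family x z {(x, y), (y, z)}"
        using assms True by (auto simp: interval_family_def)
      obtain K where "interval_family x z K"
        "(\<Sum>q\<in>{(x, y), (y, z)}. variation f (fst q) (snd q)) \<le> family_sum f K + e"
        using variation_sum_approx[OF F assms(1,4) e] by blast
      then show ?thesis using family_sum_le_variation[of x z K] assms True by auto
    qed
    then show ?thesis by (rule field_le_epsilon)
  next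
    case False
    then show ?thesis using assms nil by (cases "x = y") auto
  qed
qed

text \<open>A short family is refined until its distance sum nearly attains the sum of variations.
  The refinement is still short, so its sum is below \<open>\<epsilon>/2\<close>; the other half
  pays for the approximation.\<close>

lemma abs_cont_variation: "abs_cont_metric (variation f a) a b"
  unfolding abs_cont_metric_iff
proof (intro allI impI)
  fix \<epsilon> :: real assume "\<epsilon> > 0"
  then have e2: "\<epsilon>/2 > 0" by simp
  obtain \<delta> where "\<delta> > 0" and \<delta>: "\<And>F. interval_family a b F \<Longrightarrow> (\<Sum>p\<in>F. snd p - fst p) < \<delta> \<Longrightarrow>
        (\<Sum>p\<in>F. dist (f (snd p)) (f (fst p))) < \<epsilon>/2" using abs_cont_metricD[OF ac e2] by blast
  have "(\<Sum>p\<in>F. dist (variation f a (snd p)) (variation f a (fst p))) < \<epsilon>"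
    if F: "interval_family a b F" "(\<Sum>p\<in>F. snd p - fst p) < \<delta>" for F
  proof -
    obtain K where K: "interval_family a b K" "(\<Sum>q\<in>F. variation f (fst q) (snd q)) \<le> family_sum f K + \<epsilon>/2"
      "(\<Sum>p\<in>K. snd p - fst p) \<le> (\<Sum>q\<in>F. snd q - fst q)"
      using variation_sum_approx[OF F(1) order_refl order_refl e2] by blast
    have "dist (variation f a (snd p)) (variation f a (fst p)) = variation f (fst p) (snd p)" if "p \<in> F" for p
      using variation_add[of a "fst p" "snd p"] variation_nonneg[of "fst p" "snd p"]
        interval_family_bounds[OF F(1) that] by (auto simp: dist_real_def)
    then have "(\<Sum>p\<in>F. dist (variation f a (snd p)) (variation f a (fst p))) = (\<Sum>q\<in>F. variation f (fst q) (snd q))"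
      by simp
    then show ?thesis using K \<delta>[OF K(1)] F(2) by (simp add: family_sum_def)
  qed
  then show "\<exists>\<delta>>0. \<forall>F. interval_family a b F \<and> (\<Sum>p\<in>F. snd p - fst p) < \<delta> \<longrightarrow>
        (\<Sum>p\<in>F. dist (variation f a (snd p)) (variation f a (fst p))) < \<epsilon>"
    using \<open>\<delta> > 0\<close> by blast
qed

text \<open>\<open>P\<close> consists of the end points of a family \<open>F\<close> that nearly
  attains the variation. An interval without points of \<open>P\<close> in its interior lies inside
  a member of \<open>F\<close> or off all of them. Inside, superadditivity bounds the gaps by the
  gap of that member; outside, a gap is at most the variation. Together they fit into what
  \<open>F\<close> misses of the total variation.\<close>

lemma variation_gap:
  assumes "e > 0" "a \<le> b"
  obtains P where "finite P" "\<And>J. interval_family a b J \<Longrightarrow> \<forall>q\<in>J. P \<inter> {fst q<..<snd q} = {} \<Longrightarrow>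
    (\<Sum>q\<in>J. variation f (fst q) (snd q) - dist (f (snd q)) (f (fst q))) < e"
proof -
  obtain F where F: "interval_family a b F" and less: "variation f a b < family_sum f F + e"
    using variation_approx[OF order_refl assms(2) order_refl assms(1)] by blast
  let ?P = "fst ` F \<union> snd ` F"
  define G where "G = (\<lambda>s t. variation f s t - dist (f t) (f s))"
  have G_nonneg: "0 \<le> G s t" if "a \<le> s" "s \<le> t" "t \<le> b" for s t
    using dist_le_variation[OF that] by (simp add: G_def)
  have G_super: "G r s + G s t \<le> G r t" if "a \<le> r" "r \<le> s" "s \<le> t" "t \<le> b" for r s t
    using variation_add[OF that] dist_triangle[of "f t" "f r" "f s"] by (simp add: G_def)
  note finF = interval_family_finite[OF F] and bdF = interval_family_bounds[OF F] and djF = interval_family_disjoint[OF F]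
  show thesis
  proof (rule that)
    show "finite ?P" using finF by simp
    fix J assume J: "interval_family a b J" and avoid: "\<forall>q\<in>J. ?P \<inter> {fst q<..<snd q} = {}"
    note finJ = interval_family_finite[OF J] and bdJ = interval_family_bounds[OF J] and djJ = interval_family_disjoint[OF J]
    define inside where "inside = (\<lambda>q p :: real \<times> real. fst p \<le> fst q \<and> snd q \<le> snd p)"
    define J1 where "J1 = {q\<in>J. \<exists>p\<in>F. inside q p}"
    have fin1: "finite J1" "finite (J - J1)" using finJ by (auto simp: J1_def)
    have apart: "snd q \<le> fst p \<or> snd p \<le> fst q" if "q \<in> J - J1" "p \<in> F" for p q
      using that avoid[rule_format, of q] bdF[of p] bdJ[of q] by (force simp: J1_def inside_def)
    have FJ: "interval_family a b (F \<union> (J - J1))"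
      by (rule interval_familyI) (use finF finJ bdF bdJ djF djJ apart in blast)+
    have disj: "F \<inter> (J - J1) = {}" by (auto simp: J1_def inside_def)
    \<comment> \<open>Each \<open>q\<close> is charged to the member of \<open>F\<close> that
      contains it; interchanging the sums then groups the intervals by that member.\<close>
    have "(\<Sum>q\<in>J1. G (fst q) (snd q)) \<le> (\<Sum>q\<in>J1. \<Sum>p\<in>F. if inside q p then G (fst q) (snd q) else 0)"
    proof (rule sum_mono)
      fix q assume "q \<in> J1"
      then obtain p where p: "p \<in> F" "inside q p" "q \<in> J" by (auto simp: J1_def)
      have "0 \<le> G (fst q) (snd q)" using G_nonneg bdJ[OF p(3)] by auto
      then show "G (fst q) (snd q) \<le> (\<Sum>p\<in>F. if inside q p then G (fst q) (snd q) else 0)"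
        using member_le_sum[OF p(1), of "\<lambda>p. if inside q p then G (fst q) (snd q) else 0"] finF p(2) by auto
    qed
    also have "\<dots> = (\<Sum>p\<in>F. \<Sum>q\<in>J1. if inside q p then G (fst q) (snd q) else 0)" by (rule sum.swap)
    also have "\<dots> \<le> (\<Sum>p\<in>F. G (fst p) (snd p))"
    proof (rule sum_mono)
      fix p assume p: "p \<in> F"
      have "interval_family (fst p) (snd p) {q\<in>J1. inside q p}"
        by (rule interval_familyI) (use finJ bdJ djJ in \<open>auto simp: inside_def J1_def\<close>)
      then have "(\<Sum>q\<in>{q\<in>J1. inside q p}. G (fst q) (snd q)) \<le> G (fst p) (snd p)"
        by (rule superadditive_sum_le) (use bdF[OF p] G_nonneg G_super in auto)
      then show "(\<Sum>q\<in>J1. if inside q p then G (fst q) (snd q) else 0) \<le> G (fst p) (snd p)"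
        by (simp add: sum.inter_filter fin1)
    qed
    finally have 1: "(\<Sum>q\<in>J1. G (fst q) (snd q)) \<le> (\<Sum>p\<in>F. variation f (fst p) (snd p)) - family_sum f F"
      by (simp add: G_def family_sum_def sum_subtractf)
    have 2: "(\<Sum>q\<in>J-J1. G (fst q) (snd q)) \<le> (\<Sum>q\<in>J-J1. variation f (fst q) (snd q))"
      by (intro sum_mono) (simp add: G_def)
    have "(\<Sum>p\<in>F. variation f (fst p) (snd p)) + (\<Sum>q\<in>J-J1. variation f (fst q) (snd q))
        = (\<Sum>p\<in>F \<union> (J - J1). variation f (fst p) (snd p))"
      using disj finF fin1 by (simp add: sum.union_disjoint)
    also have "\<dots> \<le> variation f a b"
      by (rule superadditive_sum_le[OF FJ \<open>a \<le> b\<close>]) (simp_all add: variation_nonneg variation_add[symmetric])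
    finally have 3: "(\<Sum>p\<in>F. variation f (fst p) (snd p)) + (\<Sum>q\<in>J-J1. variation f (fst q) (snd q)) \<le> variation f a b" .
    have "(\<Sum>q\<in>J. G (fst q) (snd q)) = (\<Sum>q\<in>J1. G (fst q) (snd q)) + (\<Sum>q\<in>J-J1. G (fst q) (snd q))"
      using sum.subset_diff[of J1 J "\<lambda>q. G (fst q) (snd q)"] finJ by (auto simp: J1_def)
    also have "\<dots> < e" using 1 2 3 less by linarith
    finally show "(\<Sum>q\<in>J. variation f (fst q) (snd q) - dist (f (snd q)) (f (fst q))) < e"
      by (simp add: G_def)
  qed
qed

end

section \<open>Countable interval covers and Lebesgue measure\<close>

text \<open>The dyadic covering lemma in terms of end point pairs. The cover may be infinite, so
  only its finite subsets are interval families. Every interval is tagged by a point of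
  \<open>S\<close> and is fine there, as Henstock's lemma requires.\<close>

lemma interval_cover:
  fixes a b :: real
  assumes S: "S \<subseteq> {a..b}" and "a < b" and "gauge \<gamma>"
  obtains F where "countable F" "\<And>F'. finite F' \<Longrightarrow> F' \<subseteq> F \<Longrightarrow> interval_family a b F'"
    "S \<subseteq> (\<Union>p\<in>F. {fst p..snd p})"
    "\<And>p. p \<in> F \<Longrightarrow> \<exists>x\<in>S. x \<in> {fst p..snd p} \<and> {fst p..snd p} \<subseteq> \<gamma> x"
proof -
  have "S \<subseteq> cbox a b" "box a b \<noteq> {}" using S \<open>a < b\<close> by (auto simp: box_real cbox_interval)
  then obtain \<D> where \<D>: "countable \<D>"  "\<Union>\<D> \<subseteq> cbox a b"
    "\<And>K. K \<in> \<D> \<Longrightarrow> interior K \<noteq> {} \<and> (\<exists>c d. K = cbox c d)"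
    "pairwise (\<lambda>A B. interior A \<inter> interior B = {}) \<D>"
    "\<And>K. K \<in> \<D> \<Longrightarrow> \<exists>x \<in> S \<inter> K. K \<subseteq> \<gamma> x"
    "\<And>u v. cbox u v \<in> \<D> \<Longrightarrow> \<exists>n. \<forall>i \<in> Basis. v \<bullet> i - u \<bullet> i = (b \<bullet> i - a \<bullet> i) / 2^n"
    "S \<subseteq> \<Union>\<D>"
    by (rule covering_lemma[OF _ _ \<open>gauge \<gamma>\<close>]) (rule that)
  define F where "F = {p. fst p \<le> snd p \<and> {fst p..snd p} \<in> \<D>}"
  have less: "fst p < snd p" if "p \<in> F" for p
  proof -
    have "interior {fst p..snd p} \<noteq> {}" using \<D>(3)[of "{fst p..snd p}"] that by (auto simp: F_def)
    then show ?thesis by (simp add: interior_atLeastAtMost_real)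
  qed
  have inj: "inj_on (\<lambda>p::real\<times>real. {fst p..snd p}) F"
    by (rule inj_onI) (auto simp: F_def Icc_eq_Icc prod_eq_iff)
  show thesis
  proof (rule that)
    have "(\<lambda>p. {fst p..snd p}) ` F \<subseteq> \<D>" by (auto simp: F_def)
    then show "countable F"
      using countable_image_inj_on[OF countable_subset[OF _ \<D>(1)] inj] by simp
    show "interval_family a b F'" if "finite F'" and sub: "F' \<subseteq> F" for F'
    proof (rule interval_familyI)
      fix p assume "p \<in> F'"
      then have "p \<in> F" using sub by auto
      then have "{fst p..snd p} \<subseteq> \<Union>\<D>" by (auto simp: F_def)
      then have "{fst p..snd p} \<subseteq> {a..b}" using \<D>(2) unfolding cbox_interval by (rule order_trans)
      then show "a \<le> fst p \<and> fst p < snd p \<and> snd p \<le> b" using less[OF \<open>p \<in> F\<close>] by auto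
    next
      fix p q assume "p \<in> F'" "q \<in> F'" "p \<noteq> q"
      then have pq: "p \<in> F" "q \<in> F" using sub by auto
      then have "{fst p..snd p} \<noteq> {fst q..snd q}" using inj \<open>p \<noteq> q\<close> by (auto simp: inj_on_def)
      then have "interior {fst p..snd p} \<inter> interior {fst q..snd q} = {}"
        using pq by (intro pairwiseD[OF \<D>(4)]) (auto simp: F_def)
      then have disj: "{fst p<..<snd p} \<inter> {fst q<..<snd q} = {}"
        by (simp add: interior_atLeastAtMost_real)
      show "snd p \<le> fst q \<or> snd q \<le> fst p"
      proof (rule ccontr)
        assume "\<not> ?thesis"
        then have "max (fst p) (fst q) < min (snd p) (snd q)" using less[OF pq(1)] less[OF pq(2)] by auto
        then obtain z where "max (fst p) (fst q) < z" "z < min (snd p) (snd q)" using dense by blast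
        then have "z \<in> {fst p<..<snd p} \<inter> {fst q<..<snd q}" by auto
        then show False using disj by blast
      qed
    qed fact
    show "S \<subseteq> (\<Union>p\<in>F. {fst p..snd p})"
    proof
      fix x assume "x \<in> S"
      then obtain K where K: "K \<in> \<D>" "x \<in> K" using \<D>(7) by blast
      then obtain c d where "K = {c..d}" using \<D>(3)[OF K(1)] by (auto simp: cbox_interval)
      with K have "(c, d) \<in> F" "x \<in> {fst (c, d)..snd (c, d)}" by (auto simp: F_def)
      then show "x \<in> (\<Union>p\<in>F. {fst p..snd p})" by blast
    qed
    show "\<exists>x\<in>S. x \<in> {fst p..snd p} \<and> {fst p..snd p} \<subseteq> \<gamma> x" if "p \<in> F" for p
      using \<D>(5)[of "{fst p..snd p}"] that by (auto simp: F_def)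
  qed
qed

text \<open>Continuity from below along finite unions, each of which is bounded by finite
  subadditivity.\<close>

lemma emeasure_countable_UN_le:
  assumes "countable F" and A: "\<And>p. p \<in> F \<Longrightarrow> A p \<in> sets M"
    and le: "\<And>F'. finite F' \<Longrightarrow> F' \<subseteq> F \<Longrightarrow> (\<Sum>p\<in>F'. emeasure M (A p)) \<le> B"
  shows "emeasure M (\<Union>p\<in>F. A p) \<le> B"
proof (cases "F = {}")
  case False
  define e where "e = from_nat_into F"
  have e: "range e = F" unfolding e_def by (rule range_from_nat_into) (use False assms in auto)
  define C where "C n = (\<Union>p\<in>e ` {..n}. A p)" for n
  have sub: "e ` {..n} \<subseteq> F" for n using e by auto
  have "(\<Union>p\<in>F. A p) = (\<Union>n. C n)" unfolding C_def e[symmetric] by auto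
  moreover have "emeasure M (\<Union>n. C n) = (SUP n. emeasure M (C n))"
  proof (rule SUP_emeasure_incseq[symmetric])
    show "range C \<subseteq> sets M" unfolding C_def using sub A by (auto intro!: sets.finite_UN)
    show "incseq C" unfolding incseq_def C_def by (intro allI impI UN_mono image_mono) auto
  qed
  moreover have "emeasure M (C n) \<le> B" for n
  proof -
    have "A ` e ` {..n} \<subseteq> sets M" using sub[of n] A by blast
    then have "emeasure M (C n) \<le> (\<Sum>p\<in>e ` {..n}. emeasure M (A p))"
      unfolding C_def by (intro emeasure_subadditive_finite) simp
    also have "\<dots> \<le> B" by (rule le) (use sub in auto)
    finally show ?thesis .
  qed
  ultimately show ?thesis by (simp add: SUP_le_iff)
qed (use le[of "{}"] in auto)

text \<open>The closed intervals may share end points, so the disjoint open ones are measured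
  instead; the lengths are the same.\<close>

lemma interval_family_length_le_emeasure:
  assumes F: "interval_family a b F" and "\<And>p. p \<in> F \<Longrightarrow> {fst p..snd p} \<subseteq> U" and U: "U \<in> sets lebesgue"
  shows "ennreal (\<Sum>p\<in>F. snd p - fst p) \<le> emeasure lebesgue U"
proof -
  note bd = interval_family_bounds[OF F]
  have "ennreal (\<Sum>p\<in>F. snd p - fst p) = (\<Sum>p\<in>F. emeasure lebesgue {fst p<..<snd p})"
    by (subst sum_ennreal[symmetric]) (use bd in \<open>auto intro!: sum.cong simp: less_imp_le\<close>)
  also have "\<dots> = emeasure lebesgue (\<Union>p\<in>F. {fst p<..<snd p})"
  proof (rule sum_emeasure)
    show "disjoint_family_on (\<lambda>p. {fst p<..<snd p}) F"
      using interval_family_disjoint[OF F] by (force simp: disjoint_family_on_def)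
  qed (use interval_family_finite[OF F] in auto)
  also have "\<dots> \<le> emeasure lebesgue U"
    by (rule emeasure_mono) (use assms in force)+
  finally show ?thesis .
qed

text \<open>\<open>S\<close> lies in an open set \<open>U\<close> of measure below
  \<open>\<delta>\<close>, and a suitable gauge forces all intervals of the cover into
  \<open>U\<close>.\<close>

lemma negligible_interval_cover:
  fixes a b \<delta> :: real
  assumes "negligible S" "S \<subseteq> {a..b}" "a < b" "\<delta> > 0"
  obtains F where "countable F" "S \<subseteq> (\<Union>p\<in>F. {fst p..snd p})"
    "\<And>F'. finite F' \<Longrightarrow> F' \<subseteq> F \<Longrightarrow> interval_family a b F' \<and> (\<Sum>p\<in>F'. snd p - fst p) < \<delta>"
proof -
  have S: "S \<in> null_sets lebesgue" using assms(1) negligible_iff_null_sets by blast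
  obtain U where U: "open U" "S \<subseteq> U" "U - S \<in> lmeasurable" "emeasure lebesgue (U - S) < ennreal \<delta>"
    by (rule sets_lebesgue_outer_open[OF null_setsD2[OF S] \<open>\<delta> > 0\<close>]) (rule that)
  then have U\<delta>: "emeasure lebesgue U < ennreal \<delta>"
    using emeasure_Diff_null_set[OF S, of U] by simp
  \<comment> \<open>The value \<open>UNIV\<close> off \<open>U\<close> only completes the gauge: all
    tags lie in \<open>S\<close>, hence in \<open>U\<close>.\<close>
  have g: "gauge (\<lambda>x. if x \<in> U then U else UNIV)" using U(1) by (auto simp: gauge_def)
  obtain F where F: "countable F" "\<And>F'. finite F' \<Longrightarrow> F' \<subseteq> F \<Longrightarrow> interval_family a b F'"
    "S \<subseteq> (\<Union>p\<in>F. {fst p..snd p})"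
    "\<And>p. p \<in> F \<Longrightarrow> \<exists>x\<in>S. x \<in> {fst p..snd p} \<and> {fst p..snd p} \<subseteq> (if x \<in> U then U else UNIV)"
    by (rule interval_cover[OF assms(2,3) g]) (rule that)
  show thesis
  proof (rule that[OF F(1,3)])
    fix F' assume F': "finite F'" "F' \<subseteq> F"
    have "{fst p..snd p} \<subseteq> U" if p: "p \<in> F'" for p
    proof -
      obtain x where "x \<in> S" "{fst p..snd p} \<subseteq> (if x \<in> U then U else UNIV)"
        using F(4)[of p] p F'(2) by blast
      then show ?thesis using U(2) by (auto simp: subset_iff split: if_splits)
    qed
    then have "ennreal (\<Sum>p\<in>F'. snd p - fst p) \<le> emeasure lebesgue U"
      using U(1) by (intro interval_family_length_le_emeasure[OF F(2)[OF F']]) auto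
    then have "ennreal (\<Sum>p\<in>F'. snd p - fst p) < ennreal \<delta>" using U\<delta> by order
    moreover have "0 \<le> (\<Sum>p\<in>F'. snd p - fst p)"
      using interval_family_bounds[OF F(2)[OF F']] by (intro sum_nonneg) (force intro: less_imp_le)
    ultimately show "interval_family a b F' \<and> (\<Sum>p\<in>F'. snd p - fst p) < \<delta>"
      using F(2)[OF F'] by (simp add: ennreal_less_iff)
  qed
qed

section \<open>Integral representation of monotone absolutely continuous functions\<close>

text \<open>\<open>\<phi>\<close> is the Radon-Nikodym density of the Lebesgue-Stieltjes measure of
  \<open>v\<close>.\<close>

lemma mono_abs_cont_has_integral:
  fixes v :: "real \<Rightarrow> real"
  assumes ac: "abs_cont_metric v a b" and "a < b"
    and mono: "\<And>s t. a \<le> s \<Longrightarrow> s \<le> t \<Longrightarrow> t \<le> b \<Longrightarrow> v s \<le> v t"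
  obtains \<phi> where "\<And>x. 0 \<le> \<phi> x" "\<And>s t. a \<le> s \<Longrightarrow> s \<le> t \<Longrightarrow> t \<le> b \<Longrightarrow> (\<phi> has_integral (v t - v s)) {s..t}"
proof -
  \<comment> \<open>The Stieltjes measure lives on the whole line, so \<open>v\<close> is extended
    by constants; the outside then carries no mass.\<close>
  define w where "w x = v (max a (min b x))" for x
  have w_eq: "w x = v x" if "a \<le> x" "x \<le> b" for x using that by (simp add: w_def)
  have w_mono: "w x \<le> w y" if "x \<le> y" for x y
    unfolding w_def using \<open>a < b\<close> that by (intro mono) auto
  have w_cont: "continuous_on UNIV w"
    unfolding w_def
    by (rule continuous_on_compose2[OF abs_cont_metric_imp_continuous_on[OF ac]])
      (use \<open>a < b\<close> in \<open>auto intro!: continuous_intros\<close>)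
  define \<mu> where "\<mu> = interval_measure w"
  have sets_\<mu>[measurable_cong, simp]: "sets \<mu> = sets borel" by (simp add: \<mu>_def)
  have Icc: "emeasure \<mu> {s..t} = ennreal (w t - w s)" if "s \<le> t" for s t
    unfolding \<mu>_def by (rule emeasure_interval_measure_Icc[OF that w_mono w_cont])
  have "emeasure \<mu> (\<Union>n. {a - real n..a}) = 0" "emeasure \<mu> (\<Union>n. {b..b + real n}) = 0"
    by (subst emeasure_UN_eq_0; use \<open>a < b\<close> Icc in \<open>auto simp: w_def\<close>)+
  moreover have "(\<Union>n. {a - real n..a}) = {..a}"
  proof (intro equalityI subsetI)
    fix x assume "x \<in> {..a}"
    moreover obtain n :: nat where "a - x \<le> real n" using real_arch_simple by blast
    ultimately show "x \<in> (\<Union>n. {a - real n..a})" by (auto intro!: exI[of _ n])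
  qed auto
  moreover have "(\<Union>n. {b..b + real n}) = {b..}"
  proof (intro equalityI subsetI)
    fix x assume "x \<in> {b..}"
    moreover obtain n :: nat where "x - b \<le> real n" using real_arch_simple by blast
    ultimately show "x \<in> (\<Union>n. {b..b + real n})" by (auto intro!: exI[of _ n])
  qed auto
  ultimately have outside: "{..a} \<union> {b..} \<in> null_sets \<mu>"
    by (intro null_sets.Un) (auto simp: null_sets_def)
  \<comment> \<open>The part of a null set in \<open>{a..b}\<close> is covered by intervals of small
    total length, on which \<open>v\<close> grows by little in total; the growth of \<open>v\<close>
    is their measure under \<open>\<mu>\<close>.\<close>
  have "absolutely_continuous lborel \<mu>"
    unfolding absolutely_continuous_def
  proof
    fix N assume N: "N \<in> null_sets (lborel :: real measure)"
    then have Nb[measurable]: "N \<in> sets borel" by auto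
    have neg: "negligible (N \<inter> {a..b})"
      using N negligible_iff_null_sets null_sets_completionI negligible_subset by (metis inf_le1)
    have le: "emeasure \<mu> (N \<inter> {a..b}) \<le> ennreal \<epsilon>" if \<epsilon>: "\<epsilon> > 0" for \<epsilon>
    proof -
      obtain \<delta> where "\<delta> > 0" and \<delta>: "\<And>F. interval_family a b F \<Longrightarrow> (\<Sum>p\<in>F. snd p - fst p) < \<delta> \<Longrightarrow>
        (\<Sum>p\<in>F. dist (v (snd p)) (v (fst p))) < \<epsilon>" using abs_cont_metricD[OF ac \<epsilon>] by blast
      obtain F where F: "countable F" "N \<inter> {a..b} \<subseteq> (\<Union>p\<in>F. {fst p..snd p})"
        "\<And>F'. finite F' \<Longrightarrow> F' \<subseteq> F \<Longrightarrow> interval_family a b F' \<and> (\<Sum>p\<in>F'. snd p - fst p) < \<delta>"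
        using negligible_interval_cover[OF neg _ \<open>a < b\<close> \<open>\<delta> > 0\<close>] by blast
      have "emeasure \<mu> (N \<inter> {a..b}) \<le> emeasure \<mu> (\<Union>p\<in>F. {fst p..snd p})"
        by (rule emeasure_mono) (use F in \<open>auto intro!: sets.countable_UN''\<close>)
      also have "\<dots> \<le> ennreal \<epsilon>"
      proof (rule emeasure_countable_UN_le[OF F(1)])
        fix F' assume F': "finite F'" "F' \<subseteq> F"
        then have fam: "interval_family a b F'" using F(3) by blast
        have "(\<Sum>p\<in>F'. emeasure \<mu> {fst p..snd p}) = (\<Sum>p\<in>F'. ennreal (dist (v (snd p)) (v (fst p))))"
        proof (rule sum.cong)
          fix p assume "p \<in> F'"
          from interval_family_bounds[OF fam this] have "a \<le> fst p" "fst p \<le> snd p" "snd p \<le> b" by auto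
          then show "emeasure \<mu> {fst p..snd p} = ennreal (dist (v (snd p)) (v (fst p)))"
            using mono[of "fst p" "snd p"] by (simp add: Icc w_eq dist_real_def)
        qed simp
        also have "\<dots> = ennreal (\<Sum>p\<in>F'. dist (v (snd p)) (v (fst p)))" by simp
        also have "\<dots> \<le> ennreal \<epsilon>" using \<delta>[OF fam] F(3)[OF F'] by (intro ennreal_leI) auto
        finally show "(\<Sum>p\<in>F'. emeasure \<mu> {fst p..snd p}) \<le> ennreal \<epsilon>" .
      qed simp
      finally show ?thesis .
    qed
    have "emeasure \<mu> (N \<inter> {a..b}) \<le> 0"
      by (rule ennreal_le_epsilon) (simp only: add_0_left le)
    then have "N \<inter> {a..b} \<in> null_sets \<mu>" by auto
    then have "(N \<inter> {a..b}) \<union> ({..a} \<union> {b..}) \<in> null_sets \<mu>" using outside by blast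
    then show "N \<in> null_sets \<mu>" by (rule null_sets_subset) (use Nb in auto)
  qed
  then obtain f where f[measurable]: "f \<in> borel_measurable lborel" and dens: "density lborel f = \<mu>"
    using sigma_finite_measure.Radon_Nikodym[OF sigma_finite_lborel, of \<mu>] by auto
  \<comment> \<open>The density has extended values, but its integral over \<open>{a..b}\<close> is
    finite. It is thus finite almost everywhere there, and the conversion to reals changes it only
    on a null set.\<close>
  define \<phi> where "\<phi> x = enn2real (f x) * indicator {a..b} x" for x
  have \<phi>m[measurable]: "\<phi> \<in> borel_measurable borel" unfolding \<phi>_def by measurable
  have ab: "(\<integral>\<^sup>+x. f x * indicator {a..b} x \<partial>lborel) = ennreal (w b - w a)"
    using Icc[of a b] \<open>a < b\<close> emeasure_density[of f lborel "{a..b}"] by (simp add: dens)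
  have "AE x in lborel. f x * indicator {a..b} x \<noteq> \<infinity>"
    by (rule nn_integral_PInf_AE) (use ab in auto)
  then have ae: "AE x in lborel. f x * indicator {a..b} x = ennreal (\<phi> x)"
    by eventually_elim (auto simp: \<phi>_def indicator_def ennreal_enn2real_if)
  show thesis
  proof
    show "0 \<le> \<phi> x" for x by (simp add: \<phi>_def)
    fix s t assume st: "a \<le> s" "s \<le> t" "t \<le> b"
    have "ennreal (w t - w s) = (\<integral>\<^sup>+x. f x * indicator {s..t} x \<partial>lborel)"
      using Icc[of s t] st emeasure_density[of f lborel "{s..t}"] by (simp add: dens)
    also have "\<dots> = (\<integral>\<^sup>+x. ennreal (\<phi> x * indicator {s..t} x) \<partial>lborel)"
    proof (rule nn_integral_cong_AE)
      show "AE x in lborel. f x * indicator {s..t} x = ennreal (\<phi> x * indicator {s..t} x)"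
        using ae by eventually_elim (use st in \<open>auto simp: indicator_def split: if_splits\<close>)
    qed
    finally have "((\<lambda>x. \<phi> x * indicator {s..t} x) has_integral (w t - w s)) UNIV"
      by (intro nn_integral_has_integral) (use w_mono[OF st(2)] in \<open>auto simp: \<phi>_def\<close>)
    then have "((\<lambda>x. if x \<in> {s..t} then \<phi> x else 0) has_integral (w t - w s)) UNIV"
      by (rule has_integral_eq[rotated]) auto
    then show "(\<phi> has_integral (v t - v s)) {s..t}"
      unfolding has_integral_restrict_UNIV using w_eq st by simp
  qed
qed

section \<open>Almost everywhere differentiation of interval functions\<close>

text \<open>\<open>X \<eta>\<close> holds the points that are end points of arbitrarily short
  intervals on which \<open>W\<close> deviates from \<open>\<phi> x * (t - s)\<close> by more than
  \<open>\<eta>\<close> times the length. Disjoint intervals of this kind, selected by a Vitali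
  covering, have small total length: \<open>W\<close> is close to the integral by hypothesis, and
  the integral to \<open>\<phi> x * (t - s)\<close> by Henstock's lemma. So each
  \<open>X \<eta>\<close> is null.\<close>

lemma interval_function_derivative_ae:
  fixes W :: "real \<Rightarrow> real \<Rightarrow> real" and \<phi> :: "real \<Rightarrow> real"
  assumes \<phi>: "\<phi> integrable_on {a..b}"
    and W: "\<And>e. e > 0 \<Longrightarrow> \<exists>P. finite P \<and> (\<forall>J. interval_family a b J \<longrightarrow>
        (\<forall>q\<in>J. P \<inter> {fst q<..<snd q} = {}) \<longrightarrow>
        (\<Sum>q\<in>J. \<bar>W (fst q) (snd q) - integral {fst q..snd q} \<phi>\<bar>) < e)"
  obtains N where "negligible N"
    "\<And>x e. x \<in> {a..b} - N \<Longrightarrow> e > 0 \<Longrightarrow> \<exists>d>0. \<forall>s t. a \<le> s \<longrightarrow> s < t \<longrightarrow> t \<le> b \<longrightarrow> x = s \<or> x = t \<longrightarrow>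
        t - s < d \<longrightarrow> \<bar>W s t - \<phi> x * (t - s)\<bar> \<le> e * (t - s)"
proof -
  define X where "X \<eta> = {x\<in>{a..b}. \<forall>d>0. \<exists>s t. a \<le> s \<and> s < t \<and> t \<le> b \<and> (x = s \<or> x = t) \<and> t - s < d \<and>
      \<eta> * (t - s) < \<bar>W s t - \<phi> x * (t - s)\<bar>}" for \<eta>
  have "negligible (X \<eta>)" if "\<eta> > 0" for \<eta>
    unfolding negligible_outer_le
  proof (intro allI impI)
    fix e :: real assume "e > 0"
    \<comment> \<open>Two errors below \<open>e'\<close> bound \<open>\<eta>\<close> times the total
      length, which is then at most \<open>e / 5\<close>; the Vitali enlargement by the factor 5
      turns this into \<open>e\<close>.\<close>
    define e' where "e' = \<eta> * e / 10"
    have "e' > 0" using \<open>e > 0\<close> \<open>\<eta> > 0\<close> by (simp add: e'_def)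
    obtain P where "finite P" and P: "\<forall>J. interval_family a b J \<longrightarrow> (\<forall>q\<in>J. P \<inter> {fst q<..<snd q} = {}) \<longrightarrow>
        (\<Sum>q\<in>J. \<bar>W (fst q) (snd q) - integral {fst q..snd q} \<phi>\<bar>) < e'"
      using W[OF \<open>e' > 0\<close>] by blast
    have \<phi>': "\<phi> integrable_on cbox a b" using \<phi> by simp
    obtain \<gamma> where "gauge \<gamma>" and \<gamma>: "\<And>p. \<lbrakk>p tagged_partial_division_of (cbox a b); \<gamma> fine p\<rbrakk> \<Longrightarrow>
        (\<Sum>(x,k)\<in>p. norm (measure lborel k *\<^sub>R \<phi> x - integral k \<phi>)) < e'"
      by (rule Henstock_lemma[OF \<phi>' \<open>e' > 0\<close>]) (rule that)
    \<comment> \<open>An index is a triple of a tag and two end points.\<close>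
    define l r where "l i = fst (snd i)" and "r i = snd (snd i)" for i :: "real \<times> real \<times> real"
    \<comment> \<open>The bad intervals to which Henstock's lemma and the hypothesis on
      \<open>W\<close> both apply; lengths are kept below 1 because the Vitali lemma asks for
      bounded radii.\<close>
    define K where "K = {i. a \<le> l i \<and> l i < r i \<and> r i \<le> b \<and> (fst i = l i \<or> fst i = r i) \<and> r i - l i < 1 \<and>
        {l i..r i} \<subseteq> \<gamma> (fst i) \<and> P \<inter> {l i<..<r i} = {} \<and>
        \<eta> * (r i - l i) < \<bar>W (l i) (r i) - \<phi> (fst i) * (r i - l i)\<bar>}"
    define c \<rho> where "c i = (l i + r i) / 2" and "\<rho> i = (r i - l i) / 2" for i
    have cb: "cball (c i) (\<rho> i) = {l i..r i}" for i
      by (auto simp: c_def \<rho>_def cball_eq_atLeastAtMost field_simps)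
    have cover: "X \<eta> - P \<subseteq> (\<Union>i\<in>K. cball (c i) (\<rho> i))"
    proof
      fix x assume x: "x \<in> X \<eta> - P"
      obtain d1 where "d1 > 0" and d1: "ball x d1 \<subseteq> \<gamma> x"
        using \<open>gauge \<gamma>\<close> by (metis gauge_def openE)
      \<comment> \<open>Short intervals at a point off the finite set \<open>P\<close> avoid
        \<open>P\<close> altogether. The points of \<open>P\<close> themselves are added back later
        as a null set.\<close>
      have "open (- P)" using \<open>finite P\<close> by (simp add: finite_imp_closed open_Compl)
      then obtain d2 where "d2 > 0" and d2: "ball x d2 \<subseteq> - P"
        using x by (metis Compl_iff DiffE openE)
      have pos: "min 1 (min d1 d2) > 0" using \<open>d1 > 0\<close> \<open>d2 > 0\<close> by simp
      have "\<forall>d>0. \<exists>s t. a \<le> s \<and> s < t \<and> t \<le> b \<and> (x = s \<or> x = t) \<and> t - s < d \<and>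
        \<eta> * (t - s) < \<bar>W s t - \<phi> x * (t - s)\<bar>"
        using x by (simp add: X_def)
      from this[rule_format, OF pos] obtain s t where st: "a \<le> s" "s < t" "t \<le> b" "x = s \<or> x = t" "t - s < min 1 (min d1 d2)"
        "\<eta> * (t - s) < \<bar>W s t - \<phi> x * (t - s)\<bar>"
        by blast
      have "{s..t} \<subseteq> ball x d1" "{s..t} \<subseteq> ball x d2" using st by (auto simp: dist_real_def)
      moreover have "{s<..<t} \<subseteq> {s..t}" by auto
      ultimately have "{s..t} \<subseteq> \<gamma> x" "P \<inter> {s<..<t} = {}" using d1 d2 by blast+
      then have "(x, s, t) \<in> K" using st by (simp add: K_def l_def r_def)
      moreover have "x \<in> cball (c (x, s, t)) (\<rho> (x, s, t))"
        using st by (simp add: cb l_def r_def) auto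
      ultimately show "x \<in> (\<Union>i\<in>K. cball (c i) (\<rho> i))" by blast
    qed
    have rad: "0 < \<rho> i \<and> \<rho> i \<le> 1" if "i \<in> K" for i
      using that by (auto simp: K_def \<rho>_def)
    obtain C where C: "countable C" "C \<subseteq> K"
      "pairwise (\<lambda>i j. disjnt (cball (c i) (\<rho> i)) (cball (c j) (\<rho> j))) C"
      "X \<eta> - P \<subseteq> (\<Union>i\<in>C. cball (c i) (5 * \<rho> i))"
      by (rule Vitali_covering_lemma_cballs[OF cover rad]) (assumption | rule that)+
    let ?T = "\<Union>i\<in>C. cball (c i) (5 * \<rho> i)"
    have "emeasure lebesgue ?T \<le> ennreal e"
    proof (rule emeasure_countable_UN_le[OF C(1)])
      fix F assume F: "finite F" "F \<subseteq> C"
      have K: "a \<le> l i" "l i < r i" "r i \<le> b" "fst i = l i \<or> fst i = r i" "{l i..r i} \<subseteq> \<gamma> (fst i)"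
          "P \<inter> {l i<..<r i} = {}" "\<eta> * (r i - l i) < \<bar>W (l i) (r i) - \<phi> (fst i) * (r i - l i)\<bar>"
        if "i \<in> F" for i
        using that F(2) C(2) by (auto simp: K_def)
      have disj: "{l i..r i} \<inter> {l j..r j} = {}" if "i \<in> F" "j \<in> F" "i \<noteq> j" for i j
      proof -
        have "disjnt (cball (c i) (\<rho> i)) (cball (c j) (\<rho> j))"
          by (rule pairwiseD[OF C(3)]) (use that F(2) in auto)
        then show ?thesis by (simp only: cb disjnt_def)
      qed
      have inj1: "inj_on snd F"
      proof (rule inj_onI, rule ccontr)
        fix i j assume "i \<in> F" "j \<in> F" "snd i = snd j" "i \<noteq> j"
        then show False using disj[of i j] K(2)[of i] by (auto simp: l_def r_def)
      qed
      have inj2: "inj_on (\<lambda>i. (fst i, {l i..r i})) F"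
      proof (rule inj_onI, rule ccontr)
        fix i j assume "i \<in> F" "j \<in> F" "(fst i, {l i..r i}) = (fst j, {l j..r j})" "i \<noteq> j"
        then show False using disj[of i j] K(2)[of i] by auto
      qed
      have "interval_family a b (snd ` F)"
      proof (rule interval_familyI)
        fix p q assume "p \<in> snd ` F" "q \<in> snd ` F" "p \<noteq> q"
        then obtain i j where ij: "i \<in> F" "j \<in> F" "i \<noteq> j" "p = (l i, r i)" "q = (l j, r j)"
          by (auto simp: l_def r_def)
        show "snd p \<le> fst q \<or> snd q \<le> fst p"
          using disj[OF ij(1-3)] K(2)[OF ij(1)] K(2)[OF ij(2)] ij by auto
      qed (use F(1) K in \<open>auto simp: l_def r_def\<close>)
      then have "(\<Sum>q\<in>snd ` F. \<bar>W (fst q) (snd q) - integral {fst q..snd q} \<phi>\<bar>) < e'"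
        by (rule P[rule_format]) (use K(6) in \<open>fastforce simp: l_def r_def\<close>)
      then have 1: "(\<Sum>i\<in>F. \<bar>W (l i) (r i) - integral {l i..r i} \<phi>\<bar>) < e'"
        by (simp add: sum.reindex[OF inj1] l_def r_def)
      let ?p = "(\<lambda>i. (fst i, {l i..r i})) ` F"
      have "?p tagged_partial_division_of cbox a b"
        unfolding tagged_partial_division_of_def
      proof (intro conjI allI impI)
        show "finite ?p" using F(1) by simp
        fix x k assume "(x, k) \<in> ?p"
        then obtain i where i: "i \<in> F" "x = fst i" "k = {l i..r i}" by auto
        show "x \<in> k" "k \<subseteq> cbox a b" "\<exists>u v. k = cbox u v"
          using K(1-4)[OF i(1)] i by auto
      next
        fix x1 k1 x2 k2 assume p: "(x1, k1) \<in> ?p \<and> (x2, k2) \<in> ?p \<and> (x1, k1) \<noteq> (x2, k2)"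
        then obtain i j where ij: "i \<in> F" "j \<in> F" "(x1, k1) = (fst i, {l i..r i})" "(x2, k2) = (fst j, {l j..r j})"
          by blast
        then have "i \<noteq> j" "k1 = {l i..r i}" "k2 = {l j..r j}" using p by auto
        with ij(1,2) show "interior k1 \<inter> interior k2 = {}"
          using disj[of i j] interior_subset by blast
      qed
      moreover have "\<gamma> fine ?p" using K(5) by (auto simp: fine_def)
      ultimately have "(\<Sum>(x,k)\<in>?p. norm (measure lborel k *\<^sub>R \<phi> x - integral k \<phi>)) < e'" by (rule \<gamma>)
      then have "(\<Sum>i\<in>F. \<bar>measure lborel {l i..r i} * \<phi> (fst i) - integral {l i..r i} \<phi>\<bar>) < e'"
        by (simp add: sum.reindex[OF inj2])
      moreover have "measure lborel {l i..r i} = r i - l i" if "i \<in> F" for i using K(2)[OF that] by simp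
      ultimately have 2: "(\<Sum>i\<in>F. \<bar>(r i - l i) * \<phi> (fst i) - integral {l i..r i} \<phi>\<bar>) < e'" by simp
      \<comment> \<open>The deviation on a bad interval is split at the integral of
        \<open>\<phi>\<close>, which gives one term for each of the two estimates.\<close>
      have "\<eta> * (\<Sum>i\<in>F. r i - l i) \<le> (\<Sum>i\<in>F. \<bar>W (l i) (r i) - integral {l i..r i} \<phi>\<bar> +
          \<bar>(r i - l i) * \<phi> (fst i) - integral {l i..r i} \<phi>\<bar>)"
        unfolding sum_distrib_left
      proof (rule sum_mono)
        fix i assume "i \<in> F"
        from K(7)[OF this] show "\<eta> * (r i - l i) \<le> \<bar>W (l i) (r i) - integral {l i..r i} \<phi>\<bar> +
          \<bar>(r i - l i) * \<phi> (fst i) - integral {l i..r i} \<phi>\<bar>" by (simp add: mult.commute)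
      qed
      also have "\<dots> \<le> \<eta> * (e / 5)" using 1 2 by (simp add: sum.distrib e'_def)
      finally have 3: "(\<Sum>i\<in>F. r i - l i) \<le> e / 5" using \<open>\<eta> > 0\<close> by simp
      have "(\<Sum>i\<in>F. emeasure lebesgue (cball (c i) (5 * \<rho> i))) = (\<Sum>i\<in>F. ennreal (5 * (r i - l i)))"
      proof (rule sum.cong)
        have Icc: "emeasure lebesgue {x..y} = ennreal (y - x)" if "x \<le> y" for x y :: real
          using that by simp
        fix i assume "i \<in> F"
        from K(2)[OF this] have "c i - 5 * \<rho> i \<le> c i + 5 * \<rho> i" by (simp add: \<rho>_def field_simps)
        moreover have "(c i + 5 * \<rho> i) - (c i - 5 * \<rho> i) = 5 * (r i - l i)"
          by (simp add: \<rho>_def field_simps)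
        ultimately show "emeasure lebesgue (cball (c i) (5 * \<rho> i)) = ennreal (5 * (r i - l i))"
          using Icc by (simp only: cball_eq_atLeastAtMost)
      qed simp
      also have "\<dots> = ennreal (\<Sum>i\<in>F. 5 * (r i - l i))"
        by (rule sum_ennreal) (use K(2) in \<open>auto intro: less_imp_le\<close>)
      also have "\<dots> \<le> ennreal e"
        using 3 unfolding sum_distrib_left[symmetric] by (intro ennreal_leI) simp
      finally show "(\<Sum>i\<in>F. emeasure lebesgue (cball (c i) (5 * \<rho> i))) \<le> ennreal e" .
    qed simp
    moreover have Pnull: "P \<in> null_sets lebesgue"
      using \<open>finite P\<close> negligible_finite negligible_iff_null_sets by blast
    moreover have Tm: "?T \<in> sets lebesgue" using C(1) by (intro sets.countable_UN') auto
    ultimately have "emeasure lebesgue (?T \<union> P) \<le> ennreal e"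
      using emeasure_Un_null_set[OF Tm Pnull] by simp
    moreover have "?T \<union> P \<in> sets lebesgue" using Tm Pnull by auto
    moreover have "X \<eta> \<subseteq> ?T \<union> P" using C(4) by blast
    ultimately show "\<exists>T. X \<eta> \<subseteq> T \<and> T \<in> lmeasurable \<and> measure lebesgue T \<le> e"
      using \<open>e > 0\<close> by (intro exI[of _ "?T \<union> P"])
        (auto simp: fmeasurable_def measure_def less_top[symmetric] top_unique intro!: enn2real_leI)
  qed
  then have neg: "negligible (\<Union>n. X (1 / real (Suc n)))"
    by (intro negligible_countable_Union) auto
  show thesis
  proof (rule that[OF neg])
    fix x e :: real assume x: "x \<in> {a..b} - (\<Union>n. X (1 / real (Suc n)))" and "e > 0"
    then obtain n where n: "1 / real (Suc n) < e" using nat_approx_posE by blast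
    have "x \<notin> X (1 / real (Suc n))" using x by blast
    then have "\<not> (\<forall>d>0. \<exists>s t. a \<le> s \<and> s < t \<and> t \<le> b \<and> (x = s \<or> x = t) \<and> t - s < d \<and>
      1 / real (Suc n) * (t - s) < \<bar>W s t - \<phi> x * (t - s)\<bar>)"
      using x by (simp add: X_def)
    then obtain d where "d > 0" and "\<not> (\<exists>s t. a \<le> s \<and> s < t \<and> t \<le> b \<and> (x = s \<or> x = t) \<and> t - s < d \<and>
      1 / real (Suc n) * (t - s) < \<bar>W s t - \<phi> x * (t - s)\<bar>)" by blast
    then have d: "\<bar>W s t - \<phi> x * (t - s)\<bar> \<le> 1 / real (Suc n) * (t - s)"
      if "a \<le> s" "s < t" "t \<le> b" "x = s \<or> x = t" "t - s < d" for s t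
      using that not_less by blast
    have "\<bar>W s t - \<phi> x * (t - s)\<bar> \<le> e * (t - s)"
      if "a \<le> s" "s < t" "t \<le> b" "x = s \<or> x = t" "t - s < d" for s t
    proof -
      have "1 / real (Suc n) * (t - s) \<le> e * (t - s)"
        using n that by (intro mult_right_mono) auto
      with d[OF that] show ?thesis by linarith
    qed
    with \<open>d > 0\<close> show "\<exists>d>0. \<forall>s t. a \<le> s \<longrightarrow> s < t \<longrightarrow> t \<le> b \<longrightarrow> x = s \<or> x = t \<longrightarrow>
        t - s < d \<longrightarrow> \<bar>W s t - \<phi> x * (t - s)\<bar> \<le> e * (t - s)" by blast
  qed
qed

section \<open>Almost everywhere derivatives of absolutely continuous maps\<close>

text \<open>The limit of quotients as a linear approximation, free of division and of the exception
  \<open>y = x\<close>. Its inequality is weak, so the converse starts from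
  \<open>e / 2\<close>.\<close>

lemma has_metric_derivative_iff:
  "has_metric_derivative f S x L \<longleftrightarrow>
    (\<forall>e>0. \<exists>d>0. \<forall>y\<in>S. \<bar>y - x\<bar> < d \<longrightarrow> \<bar>dist (f y) (f x) - L * \<bar>y - x\<bar>\<bar> \<le> e * \<bar>y - x\<bar>)"  (is "?L = ?R")
proof
  assume ?L
  show ?R
  proof (intro allI impI)
    fix e :: real assume "e > 0"
    then obtain d where "d > 0" and d: "\<forall>t\<in>{t. x + t \<in> S}. 0 < dist t 0 \<and> dist t 0 < d \<longrightarrow>
        dist (dist (f (x + t)) (f x) / \<bar>t\<bar>) L < e"
      using \<open>?L\<close> unfolding has_metric_derivative_def Lim_within by blast
    have "\<bar>dist (f y) (f x) - L * \<bar>y - x\<bar>\<bar> \<le> e * \<bar>y - x\<bar>" if y: "y \<in> S" "\<bar>y - x\<bar> < d" for y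
    proof (cases "y = x")
      case False
      then have "dist (dist (f y) (f x) / \<bar>y - x\<bar>) L < e"
        using d[rule_format, of "y - x"] y by simp
      moreover have "dist (f y) (f x) - L * \<bar>y - x\<bar> = (dist (f y) (f x) / \<bar>y - x\<bar> - L) * \<bar>y - x\<bar>"
        using False by (simp add: field_simps)
      ultimately show ?thesis
        by (simp add: dist_real_def abs_mult mult_right_mono less_imp_le)
    qed simp
    with \<open>d > 0\<close> show "\<exists>d>0. \<forall>y\<in>S. \<bar>y - x\<bar> < d \<longrightarrow> \<bar>dist (f y) (f x) - L * \<bar>y - x\<bar>\<bar> \<le> e * \<bar>y - x\<bar>"
      by blast
  qed
next
  assume R: ?R
  show ?L
    unfolding has_metric_derivative_def Lim_within
  proof (intro allI impI)
    fix e :: real assume "e > 0"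
    then have "e / 2 > 0" by simp
    from R[rule_format, OF this] obtain d where "d > 0" and d: "\<forall>y\<in>S. \<bar>y - x\<bar> < d \<longrightarrow>
      \<bar>dist (f y) (f x) - L * \<bar>y - x\<bar>\<bar> \<le> e / 2 * \<bar>y - x\<bar>" by blast
    have "dist (dist (f (x + t)) (f x) / \<bar>t\<bar>) L < e" if t: "x + t \<in> S" "0 < dist t 0" "dist t 0 < d" for t
    proof -
      have "\<bar>dist (f (x + t)) (f x) - L * \<bar>t\<bar>\<bar> \<le> e / 2 * \<bar>t\<bar>"
        using d[rule_format, of "x + t"] t by simp
      moreover have "dist (f (x + t)) (f x) / \<bar>t\<bar> - L = (dist (f (x + t)) (f x) - L * \<bar>t\<bar>) / \<bar>t\<bar>"
        using t by (simp add: field_simps)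
      ultimately have "dist (dist (f (x + t)) (f x) / \<bar>t\<bar>) L \<le> e / 2"
        using t by (simp add: dist_real_def divide_le_eq)
      then show ?thesis using \<open>e > 0\<close> by simp
    qed
    with \<open>d > 0\<close> show "\<exists>d>0. \<forall>t\<in>{t. x + t \<in> S}. 0 < dist t 0 \<and> dist t 0 < d \<longrightarrow>
        dist (dist (f (x + t)) (f x) / \<bar>t\<bar>) L < e" by blast
  qed
qed

text \<open>\<open>\<phi>\<close> is the density of the variation. Distances fall short of the
  variation by little in total on families that avoid a finite set, so the differentiation of
  interval functions applies to \<open>dist (f t) (f s)\<close>.\<close>

lemma abs_cont_metric_derivative_ae:
  fixes f :: "real \<Rightarrow> 'm::metric_space"
  assumes ac: "abs_cont_metric f a b"
  obtains \<phi> N where "\<And>x. 0 \<le> \<phi> x" "\<phi> integrable_on {a..b}" "negligible N"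
    "\<And>x. x \<in> {a..b} - N \<Longrightarrow> has_metric_derivative f {a..b} x (\<phi> x)"
proof (cases "a < b")
  case False
  show thesis
  proof (rule that[of "\<lambda>_. 0" "{a}"])
    show "has_metric_derivative f {a..b} x 0" if "x \<in> {a..b} - {a}" for x
      using that False by auto
  qed auto
next
  case True
  then have le: "a \<le> b" by simp
  have V_diff: "variation f a t - variation f a s = variation f s t" if "a \<le> s" "s \<le> t" "t \<le> b" for s t
    using variation_add[OF ac order_refl that] by simp
  obtain \<phi> where \<phi>: "\<And>x. 0 \<le> \<phi> x"
      "\<And>s t. a \<le> s \<Longrightarrow> s \<le> t \<Longrightarrow> t \<le> b \<Longrightarrow> (\<phi> has_integral (variation f a t - variation f a s)) {s..t}"
  proof (rule mono_abs_cont_has_integral[OF abs_cont_variation[OF ac] True])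
    show "variation f a s \<le> variation f a t" if "a \<le> s" "s \<le> t" "t \<le> b" for s t
      using V_diff[OF that] variation_nonneg[OF ac that] by linarith
  qed (rule that)
  have int: "\<phi> integrable_on {a..b}" using \<phi>(2)[OF order_refl le order_refl] by blast
  have gap: "\<exists>P. finite P \<and> (\<forall>J. interval_family a b J \<longrightarrow> (\<forall>q\<in>J. P \<inter> {fst q<..<snd q} = {}) \<longrightarrow>
        (\<Sum>q\<in>J. \<bar>dist (f (snd q)) (f (fst q)) - integral {fst q..snd q} \<phi>\<bar>) < e)" if "e > 0" for e
  proof -
    obtain P where P: "finite P" "\<And>J. interval_family a b J \<Longrightarrow> \<forall>q\<in>J. P \<inter> {fst q<..<snd q} = {} \<Longrightarrow>
      (\<Sum>q\<in>J. variation f (fst q) (snd q) - dist (f (snd q)) (f (fst q))) < e"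
      by (rule variation_gap[OF ac \<open>e > 0\<close> le]) (rule that)
    have "(\<Sum>q\<in>J. \<bar>dist (f (snd q)) (f (fst q)) - integral {fst q..snd q} \<phi>\<bar>) < e"
      if J: "interval_family a b J" "\<forall>q\<in>J. P \<inter> {fst q<..<snd q} = {}" for J
    proof -
      \<comment> \<open>Distances never exceed the variation, so these absolute values are exactly
        the gaps.\<close>
      have "(\<Sum>q\<in>J. \<bar>dist (f (snd q)) (f (fst q)) - integral {fst q..snd q} \<phi>\<bar>)
        = (\<Sum>q\<in>J. variation f (fst q) (snd q) - dist (f (snd q)) (f (fst q)))"
      proof (rule sum.cong)
        fix q assume "q \<in> J"
        from interval_family_bounds[OF J(1) this] have q: "a \<le> fst q" "fst q \<le> snd q" "snd q \<le> b" by auto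
        from dist_le_variation[OF ac q] integral_unique[OF \<phi>(2)[OF q]] V_diff[OF q]
        show "\<bar>dist (f (snd q)) (f (fst q)) - integral {fst q..snd q} \<phi>\<bar> =
          variation f (fst q) (snd q) - dist (f (snd q)) (f (fst q))" by simp
      qed simp
      also have "\<dots> < e" by (rule P(2)[OF J])
      finally show ?thesis .
    qed
    with P(1) show ?thesis by blast
  qed
  obtain N where N: "negligible N"
    "\<And>x e. x \<in> {a..b} - N \<Longrightarrow> e > 0 \<Longrightarrow> \<exists>d>0. \<forall>s t. a \<le> s \<longrightarrow> s < t \<longrightarrow> t \<le> b \<longrightarrow> x = s \<or> x = t \<longrightarrow>
        t - s < d \<longrightarrow> \<bar>dist (f t) (f s) - \<phi> x * (t - s)\<bar> \<le> e * (t - s)"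
    by (rule interval_function_derivative_ae[OF int, of "\<lambda>s t. dist (f t) (f s)"]) (rule gap | rule that | assumption)+
  show thesis
  proof (rule that[OF \<phi>(1) int N(1)])
    fix x assume x: "x \<in> {a..b} - N"
    show "has_metric_derivative f {a..b} x (\<phi> x)"
      unfolding has_metric_derivative_iff
    proof (intro allI impI)
      fix e :: real assume "e > 0"
      from N(2)[OF x this] obtain d where "d > 0" and d: "\<forall>s t. a \<le> s \<longrightarrow> s < t \<longrightarrow> t \<le> b \<longrightarrow> x = s \<or> x = t \<longrightarrow>
          t - s < d \<longrightarrow> \<bar>dist (f t) (f s) - \<phi> x * (t - s)\<bar> \<le> e * (t - s)" by blast
      have "\<bar>dist (f y) (f x) - \<phi> x * \<bar>y - x\<bar>\<bar> \<le> e * \<bar>y - x\<bar>" if "y \<in> {a..b}" "\<bar>y - x\<bar> < d" for y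
        using d[rule_format, of x y] d[rule_format, of y x] that x
        by (cases x y rule: linorder_cases) (auto simp: dist_commute)
      with \<open>d > 0\<close> show "\<exists>d>0. \<forall>y\<in>{a..b}. \<bar>y - x\<bar> < d \<longrightarrow>
          \<bar>dist (f y) (f x) - \<phi> x * \<bar>y - x\<bar>\<bar> \<le> e * \<bar>y - x\<bar>" by blast
    qed
  qed
qed

text \<open>\<open>g\<close> is its variation minus the difference of variation and
  \<open>g\<close>, both increasing and absolutely continuous. Increments of \<open>g\<close> are
  then exactly integrals of \<open>\<psi>\<close>, and the empty set serves as
  \<open>P\<close>.\<close>

lemma abs_cont_real_derivative_ae:
  fixes g :: "real \<Rightarrow> real"
  assumes ac: "abs_cont_metric g a b"
  obtains \<psi> N where "\<psi> integrable_on {a..b}" "negligible N"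
    "\<And>x. x \<in> {a..b} - N \<Longrightarrow> (g has_real_derivative \<psi> x) (at x within {a..b})"
proof (cases "a < b")
  case False
  show thesis
  proof (rule that[of "\<lambda>_. 0" "{a}"])
    show "(g has_real_derivative 0) (at x within {a..b})"
      if "x \<in> {a..b} - {a}" for x using that False by auto
  qed auto
next
  case True
  then have le: "a \<le> b" by simp
  have V_diff: "variation g a t - variation g a s = variation g s t" if "a \<le> s" "s \<le> t" "t \<le> b" for s t
    using variation_add[OF ac order_refl that] by simp
  obtain \<phi>1 where \<phi>1: "\<And>x. 0 \<le> \<phi>1 x"
      "\<And>s t. a \<le> s \<Longrightarrow> s \<le> t \<Longrightarrow> t \<le> b \<Longrightarrow> (\<phi>1 has_integral (variation g a t - variation g a s)) {s..t}"
  proof (rule mono_abs_cont_has_integral[OF abs_cont_variation[OF ac] True])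
    show "variation g a s \<le> variation g a t" if "a \<le> s" "s \<le> t" "t \<le> b" for s t
      using V_diff[OF that] variation_nonneg[OF ac that] by linarith
  qed (rule that)
  obtain \<phi>2 where \<phi>2: "\<And>x. 0 \<le> \<phi>2 x"
      "\<And>s t. a \<le> s \<Longrightarrow> s \<le> t \<Longrightarrow> t \<le> b \<Longrightarrow>
        (\<phi>2 has_integral ((variation g a t - g t) - (variation g a s - g s))) {s..t}"
  proof (rule mono_abs_cont_has_integral[OF abs_cont_metric_diff[OF abs_cont_variation[OF ac] ac] True])
    show "variation g a s - g s \<le> variation g a t - g t" if "a \<le> s" "s \<le> t" "t \<le> b" for s t
      using V_diff[OF that] dist_le_variation[OF ac that] by (auto simp: dist_real_def)
  qed (rule that)
  define \<psi> where "\<psi> x = \<phi>1 x - \<phi>2 x" for x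
  have \<psi>: "(\<psi> has_integral (g t - g s)) {s..t}" if "a \<le> s" "s \<le> t" "t \<le> b" for s t
    using has_integral_diff[OF \<phi>1(2)[OF that] \<phi>2(2)[OF that]] by (simp add: \<psi>_def[abs_def])
  have int: "\<psi> integrable_on {a..b}" using \<psi>[OF order_refl le order_refl] by blast
  have gap: "\<exists>P. finite P \<and> (\<forall>J. interval_family a b J \<longrightarrow> (\<forall>q\<in>J. P \<inter> {fst q<..<snd q} = {}) \<longrightarrow>
        (\<Sum>q\<in>J. \<bar>(g (snd q) - g (fst q)) - integral {fst q..snd q} \<psi>\<bar>) < e)" if "e > 0" for e
  proof -
    have "(\<Sum>q\<in>J. \<bar>(g (snd q) - g (fst q)) - integral {fst q..snd q} \<psi>\<bar>) = 0" if J: "interval_family a b J" for J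
    proof (rule sum.neutral, rule ballI)
      fix q assume "q \<in> J"
      from interval_family_bounds[OF J(1) this] have q: "a \<le> fst q" "fst q \<le> snd q" "snd q \<le> b" by auto
      from integral_unique[OF \<psi>[OF q]] show "\<bar>(g (snd q) - g (fst q)) - integral {fst q..snd q} \<psi>\<bar> = 0" by simp
    qed
    with \<open>e > 0\<close> show ?thesis by (intro exI[of _ "{}"]) auto
  qed
  obtain N where N: "negligible N"
    "\<And>x e. x \<in> {a..b} - N \<Longrightarrow> e > 0 \<Longrightarrow> \<exists>d>0. \<forall>s t. a \<le> s \<longrightarrow> s < t \<longrightarrow> t \<le> b \<longrightarrow> x = s \<or> x = t \<longrightarrow>
        t - s < d \<longrightarrow> \<bar>(g t - g s) - \<psi> x * (t - s)\<bar> \<le> e * (t - s)"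
    by (rule interval_function_derivative_ae[OF int, of "\<lambda>s t. g t - g s"]) (rule gap | rule that | assumption)+
  show thesis
  proof (rule that[OF int N(1)])
    fix x assume x: "x \<in> {a..b} - N"
    show "(g has_real_derivative \<psi> x) (at x within {a..b})"
      unfolding has_field_derivative_iff Lim_within
    proof (intro allI impI)
      fix e :: real assume "e > 0"
      then have "e / 2 > 0" by simp
      from N(2)[OF x this] obtain d where "d > 0" and d: "\<forall>s t. a \<le> s \<longrightarrow> s < t \<longrightarrow> t \<le> b \<longrightarrow> x = s \<or> x = t \<longrightarrow>
        t - s < d \<longrightarrow> \<bar>(g t - g s) - \<psi> x * (t - s)\<bar> \<le> e / 2 * (t - s)" by blast
      have "dist ((g y - g x) / (y - x)) (\<psi> x) < e" if y: "y \<in> {a..b}" "0 < dist y x" "dist y x < d" for y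
      proof -
        have "\<bar>(g y - g x) - \<psi> x * (y - x)\<bar> \<le> e / 2 * \<bar>y - x\<bar>"
          using d[rule_format, of x y] d[rule_format, of y x] y x
          by (cases x y rule: linorder_cases) (auto simp: dist_real_def algebra_simps abs_minus_commute)
        moreover have "(g y - g x) / (y - x) - \<psi> x = ((g y - g x) - \<psi> x * (y - x)) / (y - x)"
          using y by (simp add: field_simps)
        ultimately have "dist ((g y - g x) / (y - x)) (\<psi> x) \<le> e / 2"
          using y by (simp add: dist_real_def divide_le_eq)
        then show ?thesis using \<open>e > 0\<close> by simp
      qed
      with \<open>d > 0\<close> show "\<exists>d>0. \<forall>y\<in>{a..b}. 0 < dist y x \<and> dist y x < d \<longrightarrow> dist ((g y - g x) / (y - x)) (\<psi> x) < e"
        by blast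
    qed
  qed
qed

section \<open>The measure of images\<close>

text \<open>Bounds on finite sums of lengths carry over to the union by subadditivity; the intervals
  may overlap.\<close>

lemma lmeasurable_countable_UN_Icc:
  fixes lo hi :: "'i \<Rightarrow> real"
  assumes "countable F" and le: "\<And>p. p \<in> F \<Longrightarrow> lo p \<le> hi p"
    and B: "\<And>F'. finite F' \<Longrightarrow> F' \<subseteq> F \<Longrightarrow> (\<Sum>p\<in>F'. hi p - lo p) \<le> B"
  shows "(\<Union>p\<in>F. {lo p..hi p}) \<in> lmeasurable" "measure lebesgue (\<Union>p\<in>F. {lo p..hi p}) \<le> B"
proof -
  have "0 \<le> B" using B[of "{}"] by simp
  have "emeasure lebesgue (\<Union>p\<in>F. {lo p..hi p}) \<le> ennreal B"
  proof (rule emeasure_countable_UN_le[OF assms(1)])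
    fix F' assume F': "finite F'" "F' \<subseteq> F"
    have "(\<Sum>p\<in>F'. emeasure lebesgue {lo p..hi p}) = (\<Sum>p\<in>F'. ennreal (hi p - lo p))"
      by (rule sum.cong) (use le F'(2) in auto)
    also have "\<dots> = ennreal (\<Sum>p\<in>F'. hi p - lo p)"
      by (rule sum_ennreal) (use le F'(2) in auto)
    also have "\<dots> \<le> ennreal B" using B[OF F'] by (rule ennreal_leI)
    finally show "(\<Sum>p\<in>F'. emeasure lebesgue {lo p..hi p}) \<le> ennreal B" .
  qed simp
  moreover have "(\<Union>p\<in>F. {lo p..hi p}) \<in> sets lebesgue"
    using assms(1) by (intro sets.countable_UN') auto
  ultimately show "(\<Union>p\<in>F. {lo p..hi p}) \<in> lmeasurable" "measure lebesgue (\<Union>p\<in>F. {lo p..hi p}) \<le> B"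
    using \<open>0 \<le> B\<close>
    by (auto simp: fmeasurable_def measure_def less_top[symmetric] top_unique intro!: enn2real_leI)
qed

text \<open>Lusin's condition N. On each interval of a cover of small total length, the image lies
  between the minimum and the maximum of \<open>w\<close>, attained at \<open>\<alpha> p\<close> and
  \<open>\<beta> p\<close>. The intervals between these points form a family, and absolute
  continuity bounds the sum of the oscillations.\<close>

lemma abs_cont_negligible_image:
  fixes w :: "real \<Rightarrow> real"
  assumes ac: "abs_cont_metric w a b" and N: "negligible N" "N \<subseteq> {a..b}"
  shows "negligible (w ` N)"
proof (cases "a < b")
  case False
  then have "finite N" using N(2) finite_subset[of N "{a}"] by force
  then show ?thesis by (intro negligible_finite finite_imageI)
next
  case True
  show ?thesis
    unfolding negligible_outer_le
  proof (intro allI impI)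
    fix e :: real assume "e > 0"
    obtain \<delta> where "\<delta> > 0" and \<delta>: "\<And>F. interval_family a b F \<Longrightarrow> (\<Sum>p\<in>F. snd p - fst p) < \<delta> \<Longrightarrow>
        (\<Sum>p\<in>F. dist (w (snd p)) (w (fst p))) < e"
      using abs_cont_metricD[OF ac \<open>e > 0\<close>] by blast
    obtain F where F: "countable F" "N \<subseteq> (\<Union>p\<in>F. {fst p..snd p})"
      "\<And>F'. finite F' \<Longrightarrow> F' \<subseteq> F \<Longrightarrow> interval_family a b F' \<and> (\<Sum>p\<in>F'. snd p - fst p) < \<delta>"
      by (rule negligible_interval_cover[OF N True \<open>\<delta> > 0\<close>]) (rule that)
    have bd: "a \<le> fst p" "fst p < snd p" "snd p \<le> b" if "p \<in> F" for p
      using F(3)[of "{p}"] that by (auto simp: interval_family_def)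
    have cont: "continuous_on {fst p..snd p} w" if "p \<in> F" for p
      using bd[OF that] by (intro continuous_on_subset[OF abs_cont_metric_imp_continuous_on[OF ac]]) auto
    have "\<exists>\<alpha>\<in>{fst p..snd p}. \<forall>x\<in>{fst p..snd p}. w \<alpha> \<le> w x" if "p \<in> F" for p
      using continuous_attains_inf[OF compact_Icc _ cont[OF that]] bd[OF that] by auto
    then obtain \<alpha> where \<alpha>: "\<And>p. p \<in> F \<Longrightarrow> \<alpha> p \<in> {fst p..snd p}"
      "\<And>p x. p \<in> F \<Longrightarrow> x \<in> {fst p..snd p} \<Longrightarrow> w (\<alpha> p) \<le> w x" by metis
    have "\<exists>\<beta>\<in>{fst p..snd p}. \<forall>x\<in>{fst p..snd p}. w x \<le> w \<beta>" if "p \<in> F" for p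
      using continuous_attains_sup[OF compact_Icc _ cont[OF that]] bd[OF that] by auto
    then obtain \<beta> where \<beta>: "\<And>p. p \<in> F \<Longrightarrow> \<beta> p \<in> {fst p..snd p}"
      "\<And>p x. p \<in> F \<Longrightarrow> x \<in> {fst p..snd p} \<Longrightarrow> w x \<le> w (\<beta> p)" by metis
    let ?T = "\<Union>p\<in>F. {w (\<alpha> p)..w (\<beta> p)}"
    have le: "w (\<alpha> p) \<le> w (\<beta> p)" if "p \<in> F" for p using \<alpha>(2)[OF that \<beta>(1)[OF that]] .
    have sums: "(\<Sum>p\<in>F'. w (\<beta> p) - w (\<alpha> p)) \<le> e" if F': "finite F'" "F' \<subseteq> F" for F'
    proof -
      \<comment> \<open>Either extremal point may come first, hence \<open>min\<close> and
        \<open>max\<close>. Where the two coincide, the interval would be degenerate and the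
        oscillation is zero.\<close>
      let ?k = "\<lambda>p. (min (\<alpha> p) (\<beta> p), max (\<alpha> p) (\<beta> p))"
      let ?F = "{p\<in>F'. \<alpha> p \<noteq> \<beta> p}"
      have fam: "interval_family a b F'" using F(3)[OF F'] by blast
      have in_p: "fst p \<le> min (\<alpha> p) (\<beta> p)" "max (\<alpha> p) (\<beta> p) \<le> snd p" if "p \<in> F'" for p
        using \<alpha>(1)[of p] \<beta>(1)[of p] that F'(2) by auto
      have dj: "max (\<alpha> p) (\<beta> p) \<le> min (\<alpha> q) (\<beta> q) \<or> max (\<alpha> q) (\<beta> q) \<le> min (\<alpha> p) (\<beta> p)"
        if "p \<in> F'" "q \<in> F'" "p \<noteq> q" for p q
        using interval_family_disjoint[OF fam that] in_p[OF that(1)] in_p[OF that(2)] by linarith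
      have inj: "inj_on ?k ?F"
      proof (rule inj_onI, rule ccontr)
        fix p q assume pq: "p \<in> ?F" "q \<in> ?F" "?k p = ?k q" "p \<noteq> q"
        then show False using dj[of p q] by (auto simp: min_def max_def split: if_splits)
      qed
      have "interval_family a b (?k ` ?F)"
      proof (rule interval_familyI)
        fix p assume "p \<in> ?k ` ?F"
        then obtain q where q: "q \<in> F'" "\<alpha> q \<noteq> \<beta> q" "p = ?k q" by blast
        then show "a \<le> fst p \<and> fst p < snd p \<and> snd p \<le> b"
          using in_p[OF q(1)] bd[of q] F'(2) by auto
      next
        fix p q assume "p \<in> ?k ` ?F" "q \<in> ?k ` ?F" "p \<noteq> q"
        then obtain p' q' where "p' \<in> F'" "q' \<in> F'" "p' \<noteq> q'" "p = ?k p'" "q = ?k q'" by blast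
        then show "snd p \<le> fst q \<or> snd q \<le> fst p" using dj[of p' q'] by simp
      qed (use F'(1) in simp)
      moreover have "(\<Sum>p\<in>?k ` ?F. snd p - fst p) < \<delta>"
      proof -
        have "(\<Sum>p\<in>?k ` ?F. snd p - fst p) = (\<Sum>p\<in>?F. max (\<alpha> p) (\<beta> p) - min (\<alpha> p) (\<beta> p))"
          by (simp add: sum.reindex[OF inj])
        also have "\<dots> \<le> (\<Sum>p\<in>?F. snd p - fst p)"
          by (rule sum_mono, rule diff_mono) (use in_p in auto)
        also have "\<dots> \<le> (\<Sum>p\<in>F'. snd p - fst p)"
          by (rule sum_mono2) (use F'(1) interval_family_bounds[OF fam] in \<open>auto intro: less_imp_le\<close>)
        finally show ?thesis using F(3)[OF F'] by simp
      qed
      ultimately have "(\<Sum>p\<in>?k ` ?F. dist (w (snd p)) (w (fst p))) < e" by (rule \<delta>)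
      then have "(\<Sum>p\<in>?F. dist (w (max (\<alpha> p) (\<beta> p))) (w (min (\<alpha> p) (\<beta> p)))) < e"
        by (simp add: sum.reindex[OF inj])
      moreover have "(\<Sum>p\<in>?F. w (\<beta> p) - w (\<alpha> p)) \<le> (\<Sum>p\<in>?F. dist (w (max (\<alpha> p) (\<beta> p))) (w (min (\<alpha> p) (\<beta> p))))"
        by (rule sum_mono) (auto simp: dist_real_def min_def max_def)
      moreover have "(\<Sum>p\<in>F'. w (\<beta> p) - w (\<alpha> p)) = (\<Sum>p\<in>?F. w (\<beta> p) - w (\<alpha> p))"
        by (rule sum.mono_neutral_right) (use F'(1) in auto)
      ultimately show ?thesis by linarith
    qed
    have "w ` N \<subseteq> ?T"
    proof
      fix y assume "y \<in> w ` N"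
      then obtain x where x: "x \<in> N" "y = w x" by blast
      then obtain p where p: "p \<in> F" "x \<in> {fst p..snd p}" using F(2) by blast
      then show "y \<in> ?T" using \<alpha>(2)[OF p] \<beta>(2)[OF p] x(2) by auto
    qed
    then show "\<exists>T. w ` N \<subseteq> T \<and> T \<in> lmeasurable \<and> measure lebesgue T \<le> e"
      using lmeasurable_countable_UN_Icc[of F "\<lambda>p. w (\<alpha> p)" "\<lambda>p. w (\<beta> p)" e] F(1) le sums by blast
  qed
qed

lemma integral_superadditive_sum_le:
  fixes k :: "real \<Rightarrow> real"
  assumes F: "interval_family a b F" and "a \<le> b" and int: "k integrable_on {a..b}" and "\<And>x. 0 \<le> k x"
  shows "(\<Sum>p\<in>F. integral {fst p..snd p} k) \<le> integral {a..b} k"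
proof (rule superadditive_sum_le[OF F \<open>a \<le> b\<close>, of "\<lambda>s t. integral {s..t} k"])
  \<comment> \<open>Where \<open>k\<close> is not integrable, the integral has the default value
    0.\<close>
  show "0 \<le> integral {s..t} k" for s t
    using assms(4) by (cases "k integrable_on {s..t}") (auto intro: integral_nonneg simp: not_integrable_integral)
  show "integral {r..s} k + integral {s..t} k \<le> integral {r..t} k" if "a \<le> r" "r \<le> s" "s \<le> t" "t \<le> b" for r s t
  proof -
    have "k integrable_on {r..t}"
      by (rule integrable_on_subinterval[OF int]) (use that in auto)
    then show ?thesis
      using Henstock_Kurzweil_Integration.integral_combine[OF that(2,3), of k] by simp
  qed
qed

lemma measure_image_le_integral:
  fixes u \<phi> :: "real \<Rightarrow> real"
  assumes "a < b" "E \<subseteq> {a..b}" and int: "\<phi> integrable_on {a..b}" and nonneg: "\<And>x. 0 \<le> \<phi> x"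
    and growth: "\<And>x e. x \<in> E \<Longrightarrow> e > 0 \<Longrightarrow> \<exists>d>0. \<forall>y\<in>{a..b}. \<bar>y - x\<bar> < d \<longrightarrow> \<bar>u y - u x\<bar> \<le> (\<phi> x + e) * \<bar>y - x\<bar>"
    and "e > 0"
  shows "\<exists>T. u ` E \<subseteq> T \<and> T \<in> lmeasurable \<and> measure lebesgue T \<le> 2 * integral {a..b} \<phi> + e"
proof -
  \<comment> \<open>Henstock's lemma costs \<open>2 * e'\<close> and the growth condition
    \<open>2 * e' * (b - a)\<close>, in all \<open>2 * e' * k = e\<close>.\<close>
  define k where "k = 1 + (b - a)"
  have "k > 0" using \<open>a < b\<close> by (simp add: k_def)
  define e' where "e' = e / (2 * k)"
  have "e' > 0" using \<open>e > 0\<close> \<open>k > 0\<close> by (simp add: e'_def)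
  have int': "\<phi> integrable_on cbox a b" using int by simp
  obtain \<gamma> where "gauge \<gamma>" and \<gamma>: "\<And>p. \<lbrakk>p tagged_partial_division_of (cbox a b); \<gamma> fine p\<rbrakk> \<Longrightarrow>
        (\<Sum>(x,k)\<in>p. norm (measure lborel k *\<^sub>R \<phi> x - integral k \<phi>)) < e'"
    by (rule Henstock_lemma[OF int' \<open>e' > 0\<close>]) (rule that)
  have "\<forall>x. \<exists>d>0. x \<in> E \<longrightarrow> (\<forall>y\<in>{a..b}. \<bar>y - x\<bar> < d \<longrightarrow> \<bar>u y - u x\<bar> \<le> (\<phi> x + e') * \<bar>y - x\<bar>)"
    using growth[OF _ \<open>e' > 0\<close>] zero_less_one by metis
  then obtain d where d: "\<And>x. d x > 0"
    "\<And>x y. x \<in> E \<Longrightarrow> y \<in> {a..b} \<Longrightarrow> \<bar>y - x\<bar> < d x \<Longrightarrow> \<bar>u y - u x\<bar> \<le> (\<phi> x + e') * \<bar>y - x\<bar>" by metis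
  have "gauge (\<lambda>x. \<gamma> x \<inter> ball x (d x))"
    using \<open>gauge \<gamma>\<close> d(1) by (auto simp: gauge_def)
  then obtain F where F: "countable F" "\<And>F'. finite F' \<Longrightarrow> F' \<subseteq> F \<Longrightarrow> interval_family a b F'"
    "E \<subseteq> (\<Union>p\<in>F. {fst p..snd p})"
    "\<And>p. p \<in> F \<Longrightarrow> \<exists>x\<in>E. x \<in> {fst p..snd p} \<and> {fst p..snd p} \<subseteq> \<gamma> x \<inter> ball x (d x)"
    by (rule interval_cover[OF assms(2,1)]) (rule that)
  obtain \<xi> where \<xi>: "\<And>p. p \<in> F \<Longrightarrow> \<xi> p \<in> E" "\<And>p. p \<in> F \<Longrightarrow> \<xi> p \<in> {fst p..snd p}"
    "\<And>p. p \<in> F \<Longrightarrow> {fst p..snd p} \<subseteq> \<gamma> (\<xi> p) \<inter> ball (\<xi> p) (d (\<xi> p))"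
    using F(4) by metis
  have bd: "a \<le> fst p" "fst p < snd p" "snd p \<le> b" if "p \<in> F" for p
    using F(2)[of "{p}"] that by (auto simp: interval_family_def)
  define \<rho> where "\<rho> p = (\<phi> (\<xi> p) + e') * (snd p - fst p)" for p
  let ?lo = "\<lambda>p. u (\<xi> p) - \<rho> p" and ?hi = "\<lambda>p. u (\<xi> p) + \<rho> p"
  have \<rho>: "0 \<le> \<rho> p" if "p \<in> F" for p
    using bd[OF that] nonneg[of "\<xi> p"] \<open>e' > 0\<close> by (simp add: \<rho>_def)
  have sums: "(\<Sum>p\<in>F'. ?hi p - ?lo p) \<le> 2 * integral {a..b} \<phi> + e" if F': "finite F'" "F' \<subseteq> F" for F'
  proof -
    note fam = F(2)[OF F']
    have sub: "p \<in> F" if "p \<in> F'" for p using that F'(2) by blast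
    let ?tag = "\<lambda>p. (\<xi> p, {fst p..snd p})"
    have inj: "inj_on ?tag F'"
    proof (rule inj_onI)
      fix p q assume "p \<in> F'" "q \<in> F'" "?tag p = ?tag q"
      then show "p = q" using bd(2)[of p] bd(2)[of q] F'(2) by (auto simp: Icc_eq_Icc prod_eq_iff)
    qed
    have "?tag ` F' tagged_partial_division_of cbox a b"
      unfolding tagged_partial_division_of_def
    proof (intro conjI allI impI)
      show "finite (?tag ` F')" using F'(1) by simp
      fix x k assume "(x, k) \<in> ?tag ` F'"
      then obtain p where p: "p \<in> F" "x = \<xi> p" "k = {fst p..snd p}" using sub by blast
      show "x \<in> k" using \<xi>(2)[OF p(1)] p by simp
      show "k \<subseteq> cbox a b" using bd[OF p(1)] p by auto
      show "\<exists>u v. k = cbox u v" using p(3) by (metis cbox_interval)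
    next
      fix x1 k1 x2 k2 assume h: "(x1, k1) \<in> ?tag ` F' \<and> (x2, k2) \<in> ?tag ` F' \<and> (x1, k1) \<noteq> (x2, k2)"
      then obtain p q where pq: "p \<in> F'" "q \<in> F'" "(x1, k1) = ?tag p" "(x2, k2) = ?tag q" by blast
      then have "p \<noteq> q" using h by auto
      then show "interior k1 \<inter> interior k2 = {}"
        using interval_family_disjoint[OF fam pq(1,2)] pq(3,4) by (auto simp: interior_atLeastAtMost_real)
    qed
    moreover have "\<gamma> fine ?tag ` F'" using \<xi>(3) sub unfolding fine_def by blast
    ultimately have "(\<Sum>(x,k)\<in>?tag ` F'. norm (measure lborel k *\<^sub>R \<phi> x - integral k \<phi>)) < e'" by (rule \<gamma>)
    then have "(\<Sum>p\<in>F'. \<bar>measure lborel {fst p..snd p} * \<phi> (\<xi> p) - integral {fst p..snd p} \<phi>\<bar>) < e'"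
      by (simp add: sum.reindex[OF inj])
    moreover have "(\<Sum>p\<in>F'. (snd p - fst p) * \<phi> (\<xi> p) - integral {fst p..snd p} \<phi>)
      \<le> (\<Sum>p\<in>F'. \<bar>measure lborel {fst p..snd p} * \<phi> (\<xi> p) - integral {fst p..snd p} \<phi>\<bar>)"
      by (rule sum_mono) (use bd(2)[OF sub] in \<open>simp add: less_imp_le\<close>)
    ultimately have 1: "(\<Sum>p\<in>F'. (snd p - fst p) * \<phi> (\<xi> p)) \<le> (\<Sum>p\<in>F'. integral {fst p..snd p} \<phi>) + e'"
      by (simp add: sum_subtractf)
    have 2: "(\<Sum>p\<in>F'. integral {fst p..snd p} \<phi>) \<le> integral {a..b} \<phi>"
      using integral_superadditive_sum_le[OF fam less_imp_le[OF \<open>a < b\<close>] int nonneg] .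
    have 3: "(\<Sum>p\<in>F'. snd p - fst p) \<le> b - a"
      using interval_family_length_le[OF fam] \<open>a < b\<close> by simp
    have "(\<Sum>p\<in>F'. ?hi p - ?lo p) = 2 * (\<Sum>p\<in>F'. (snd p - fst p) * \<phi> (\<xi> p)) + 2 * e' * (\<Sum>p\<in>F'. snd p - fst p)"
      unfolding sum_distrib_left sum.distrib[symmetric] by (rule sum.cong) (simp_all add: \<rho>_def algebra_simps)
    also have "\<dots> \<le> 2 * (integral {a..b} \<phi> + e') + 2 * e' * (b - a)"
      using 1 2 3 \<open>e' > 0\<close> by (intro add_mono mult_left_mono) auto
    also have "\<dots> = 2 * integral {a..b} \<phi> + 2 * (e' * k)" by (simp add: k_def algebra_simps)
    also have "2 * (e' * k) = e"
      using \<open>k > 0\<close> by (simp add: e'_def)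
    finally show ?thesis .
  qed
  have "u ` E \<subseteq> (\<Union>p\<in>F. {?lo p..?hi p})"
  proof
    fix y assume "y \<in> u ` E"
    then obtain x where x: "x \<in> E" "y = u x" by blast
    then obtain p where p: "p \<in> F" "x \<in> {fst p..snd p}" using F(3) by blast
    have "\<bar>x - \<xi> p\<bar> < d (\<xi> p)" using \<xi>(3)[OF p(1)] p(2) by (auto simp: dist_real_def abs_minus_commute)
    then have "\<bar>u x - u (\<xi> p)\<bar> \<le> (\<phi> (\<xi> p) + e') * \<bar>x - \<xi> p\<bar>"
      using \<xi>(1)[OF p(1)] x(1) assms(2) by (intro d(2)) auto
    also have "\<dots> \<le> \<rho> p"
      unfolding \<rho>_def using \<xi>(2)[OF p(1)] p(2) nonneg[of "\<xi> p"] \<open>e' > 0\<close> by (intro mult_left_mono) auto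
    finally have "y \<in> {?lo p..?hi p}" using x(2) by auto
    then show "y \<in> (\<Union>p\<in>F. {?lo p..?hi p})" using p(1) by blast
  qed
  moreover have "?lo p \<le> ?hi p" if "p \<in> F" for p using \<rho>[OF that] by simp
  ultimately show ?thesis
    using lmeasurable_countable_UN_Icc[OF F(1), of ?lo ?hi, OF _ sums] by blast
qed

section \<open>Uniqueness and chain rule for metric derivatives\<close>

text \<open>In a nondegenerate interval there are other points arbitrarily near \<open>x\<close>, at
  which the two linear approximations are compared. On a one-point interval every number would be a
  metric derivative.\<close>

lemma has_metric_derivative_unique:
  assumes L: "has_metric_derivative f {a..b} x L" and L': "has_metric_derivative f {a..b} x L'"
    and "a < b" "x \<in> {a..b}"
  shows "L = L'"
proof (rule ccontr)
  assume "L \<noteq> L'"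
  \<comment> \<open>The comparison gives \<open>\<bar>L - L'\<bar> \<le> 2 * e\<close>, whereas the
    left side is \<open>3 * e\<close>.\<close>
  define e where "e = \<bar>L - L'\<bar> / 3"
  have "e > 0" using \<open>L \<noteq> L'\<close> by (simp add: e_def)
  from L[unfolded has_metric_derivative_iff, rule_format, OF this]
  obtain d1 where "d1 > 0" and d1: "\<forall>y\<in>{a..b}. \<bar>y - x\<bar> < d1 \<longrightarrow>
      \<bar>dist (f y) (f x) - L * \<bar>y - x\<bar>\<bar> \<le> e * \<bar>y - x\<bar>" by blast
  from L'[unfolded has_metric_derivative_iff, rule_format, OF \<open>e > 0\<close>]
  obtain d2 where "d2 > 0" and d2: "\<forall>y\<in>{a..b}. \<bar>y - x\<bar> < d2 \<longrightarrow>
      \<bar>dist (f y) (f x) - L' * \<bar>y - x\<bar>\<bar> \<le> e * \<bar>y - x\<bar>" by blast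
  define d where "d = min d1 d2"
  have "d > 0" using \<open>d1 > 0\<close> \<open>d2 > 0\<close> by (simp add: d_def)
  obtain y where y: "y \<in> {a..b}" "y \<noteq> x" "\<bar>y - x\<bar> < d"
  proof (cases "x < b")
    case True
    then show ?thesis using that[of "min b (x + d/2)"] assms(4) \<open>d > 0\<close> by (auto simp: min_def)
  next
    case False
    then show ?thesis using that[of "max a (x - d/2)"] assms(3,4) \<open>d > 0\<close> by (auto simp: max_def)
  qed
  have "\<bar>dist (f y) (f x) - L * \<bar>y - x\<bar>\<bar> \<le> e * \<bar>y - x\<bar>" "\<bar>dist (f y) (f x) - L' * \<bar>y - x\<bar>\<bar> \<le> e * \<bar>y - x\<bar>"
    using d1 d2 y by (auto simp: d_def)
  then have "\<bar>L * \<bar>y - x\<bar> - L' * \<bar>y - x\<bar>\<bar> \<le> 2 * e * \<bar>y - x\<bar>" by linarith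
  then have "\<bar>L - L'\<bar> * \<bar>y - x\<bar> \<le> 2 * e * \<bar>y - x\<bar>" by (simp add: abs_mult left_diff_distrib[symmetric])
  then have "\<bar>L - L'\<bar> \<le> 2 * e" using y(2) by simp
  then show False using \<open>e > 0\<close> by (simp add: e_def)
qed

text \<open>With \<open>t = \<bar>y - x\<bar>\<close> and \<open>B = \<bar>g y - g x\<bar>\<close>,
  the error splits into that of \<open>f\<close> at distance \<open>B\<close> and
  \<open>L * (B - \<bar>D\<bar> * t)\<close>.\<close>

lemma has_metric_derivative_compose:
  assumes f: "has_metric_derivative f T (g x) L" and g: "(g has_real_derivative D) (at x within S)"
    and "g ` S \<subseteq> T"
  shows "has_metric_derivative (f \<circ> g) S x (L * \<bar>D\<bar>)"
  unfolding has_metric_derivative_iff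
proof (intro allI impI)
  fix e :: real assume "e > 0"
  \<comment> \<open>\<open>m\<close> and \<open>l\<close> exceed \<open>\<bar>D\<bar>\<close> and
    \<open>\<bar>L\<bar>\<close> by 1 to be positive divisors. The two halves of the error are
    \<open>e1 * m = e / 2\<close> and \<open>l * e2 \<le> e / 2\<close>; \<open>e2 \<le> 1\<close>
    gives \<open>B \<le> m * t\<close>.\<close>
  define m where "m = \<bar>D\<bar> + 1"
  have "m > 0" by (simp add: m_def add_nonneg_pos)
  define e1 where "e1 = e / (2 * m)"
  define l where "l = \<bar>L\<bar> + 1"
  have "l > 0" by (simp add: l_def add_nonneg_pos)
  define e2 where "e2 = min 1 (e / (2 * l))"
  have "e1 > 0" "e2 > 0" using \<open>e > 0\<close> \<open>m > 0\<close> \<open>l > 0\<close> by (simp_all add: e1_def e2_def add_nonneg_pos)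
  from f[unfolded has_metric_derivative_iff, rule_format, OF \<open>e1 > 0\<close>]
  obtain d1 where "d1 > 0" and d1: "\<forall>z\<in>T. \<bar>z - g x\<bar> < d1 \<longrightarrow>
      \<bar>dist (f z) (f (g x)) - L * \<bar>z - g x\<bar>\<bar> \<le> e1 * \<bar>z - g x\<bar>" by blast
  have "\<forall>e>0. \<exists>d>0. \<forall>y\<in>S. norm (y - x) < d \<longrightarrow> norm (g y - g x - D * (y - x)) \<le> e * norm (y - x)"
    using g unfolding has_field_derivative_def has_derivative_within_alt by simp
  from this[rule_format, OF \<open>e2 > 0\<close>]
  obtain d2 where "d2 > 0" and d2: "\<forall>y\<in>S. \<bar>y - x\<bar> < d2 \<longrightarrow>
      \<bar>g y - g x - D * (y - x)\<bar> \<le> e2 * \<bar>y - x\<bar>" by auto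
  define d where "d = min d2 (d1 / m)"
  have "d > 0" using \<open>d1 > 0\<close> \<open>d2 > 0\<close> \<open>m > 0\<close> by (simp add: d_def)
  have "\<bar>dist ((f \<circ> g) y) ((f \<circ> g) x) - L * \<bar>D\<bar> * \<bar>y - x\<bar>\<bar> \<le> e * \<bar>y - x\<bar>"
    if y: "y \<in> S" "\<bar>y - x\<bar> < d" for y
  proof -
    define A where "A = dist (f (g y)) (f (g x))"
    define B where "B = \<bar>g y - g x\<bar>"
    define t where "t = \<bar>y - x\<bar>"
    have "t \<ge> 0" by (simp add: t_def)
    have "\<bar>g y - g x - D * (y - x)\<bar> \<le> e2 * t" using d2 y by (auto simp: d_def t_def)
    moreover have "\<bar>D * (y - x)\<bar> = \<bar>D\<bar> * t" by (simp add: abs_mult t_def)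
    ultimately have B: "\<bar>B - \<bar>D\<bar> * t\<bar> \<le> e2 * t" unfolding B_def by linarith
    have "e2 * t \<le> 1 * t" using \<open>t \<ge> 0\<close> by (intro mult_right_mono) (auto simp: e2_def)
    then have B1: "B \<le> m * t" using B by (simp add: m_def algebra_simps)
    also have "\<dots> < d1" using y(2) \<open>m > 0\<close> by (simp add: d_def t_def pos_less_divide_eq mult.commute)
    finally have "\<bar>A - L * B\<bar> \<le> e1 * B"
      using d1 y(1) \<open>g ` S \<subseteq> T\<close> unfolding A_def B_def by blast
    also have "\<dots> \<le> e1 * (m * t)" using B1 \<open>e1 > 0\<close> by (intro mult_left_mono) auto
    also have "\<dots> = e / 2 * t" using \<open>m > 0\<close> by (simp add: e1_def)
    finally have 1: "\<bar>A - L * B\<bar> \<le> e / 2 * t" .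
    have "\<bar>L * B - L * \<bar>D\<bar> * t\<bar> = \<bar>L\<bar> * \<bar>B - \<bar>D\<bar> * t\<bar>"
      by (simp add: abs_mult[symmetric] algebra_simps)
    also have "\<dots> \<le> \<bar>L\<bar> * (e2 * t)" using B by (intro mult_left_mono) auto
    also have "\<dots> \<le> l * (e / (2 * l) * t)"
      using \<open>t \<ge> 0\<close> \<open>e2 > 0\<close> by (intro mult_mono mult_right_mono) (auto simp: e2_def l_def)
    also have "\<dots> = e / 2 * t" using \<open>l > 0\<close> by simp
    finally show ?thesis using 1 unfolding A_def t_def comp_def by linarith
  qed
  with \<open>d > 0\<close> show "\<exists>d>0. \<forall>y\<in>S. \<bar>y - x\<bar> < d \<longrightarrow>
      \<bar>dist ((f \<circ> g) y) ((f \<circ> g) x) - L * \<bar>D\<bar> * \<bar>y - x\<bar>\<bar> \<le> e * \<bar>y - x\<bar>" by blast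
qed

section \<open>Distances bounded by integrals\<close>

text \<open>Absolute continuity of the integral: \<open>k\<close> is truncated at a level
  \<open>n\<close> so high that the excess has integral below \<open>\<epsilon> / 2\<close>; the
  truncated part contributes at most \<open>n\<close> times the total length.\<close>

lemma abs_cont_metric_if_dist_le_integral:
  fixes F :: "real \<Rightarrow> 'm::metric_space" and k :: "real \<Rightarrow> real"
  assumes int: "k integrable_on {a..b}" and nonneg: "\<And>x. 0 \<le> k x" and "a \<le> b"
    and le: "\<And>s t. a \<le> s \<Longrightarrow> s \<le> t \<Longrightarrow> t \<le> b \<Longrightarrow> dist (F t) (F s) \<le> integral {s..t} k"
  shows "abs_cont_metric F a b"
  unfolding abs_cont_metric_iff
proof (intro allI impI)
  fix \<epsilon> :: real assume "\<epsilon> > 0"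
  let ?k = "\<lambda>n x. min (k x) (real n)"
  have k_int: "?k n integrable_on {a..b}" for n
  proof -
    have [measurable]: "k \<in> borel_measurable (lebesgue_on {a..b})" by (rule integrable_imp_measurable[OF int])
    have "?k n absolutely_integrable_on {a..b}"
      by (rule measurable_bounded_by_integrable_imp_absolutely_integrable[OF _ _ int]) (use nonneg in auto)
    then show ?thesis by (simp add: absolutely_integrable_on_def)
  qed
  have "(\<lambda>n. integral {a..b} (?k n)) \<longlonglongrightarrow> integral {a..b} k"
  proof (rule dominated_convergence(2)[OF k_int int])
    fix x
    obtain N :: nat where "k x \<le> real N" using real_arch_simple by blast
    then have "\<forall>\<^sub>F n in sequentially. ?k n x = k x"
      by (intro eventually_sequentiallyI[of N]) auto
    then show "(\<lambda>n. ?k n x) \<longlonglongrightarrow> k x" by (rule tendsto_eventually)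
  qed (use nonneg in auto)
  then have "\<forall>\<^sub>F n in sequentially. dist (integral {a..b} (?k n)) (integral {a..b} k) < \<epsilon> / 2"
    using \<open>\<epsilon> > 0\<close> by (intro tendstoD) auto
  then obtain n where n: "dist (integral {a..b} (?k n)) (integral {a..b} k) < \<epsilon> / 2"
    by (auto simp: eventually_sequentially)
  let ?r = "\<lambda>x. k x - ?k n x"
  have r_int: "?r integrable_on {a..b}" by (intro integrable_diff int k_int)
  have r: "integral {a..b} ?r < \<epsilon> / 2"
    using n integral_diff[OF int k_int[of n]] unfolding dist_real_def by linarith
  \<comment> \<open>The added 1 keeps the divisor in \<open>\<delta>\<close> positive if
    \<open>n = 0\<close>.\<close>
  define m where "m = real n + 1"
  have "m > 0" by (simp add: m_def)
  define \<delta> where "\<delta> = \<epsilon> / (2 * m)"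
  have "\<delta> > 0" using \<open>\<epsilon> > 0\<close> \<open>m > 0\<close> by (simp add: \<delta>_def)
  have "(\<Sum>p\<in>J. dist (F (snd p)) (F (fst p))) < \<epsilon>"
    if J: "interval_family a b J" "(\<Sum>p\<in>J. snd p - fst p) < \<delta>" for J
  proof -
    have "(\<Sum>p\<in>J. dist (F (snd p)) (F (fst p))) \<le> (\<Sum>p\<in>J. integral {fst p..snd p} ?r + real n * (snd p - fst p))"
    proof (rule sum_mono)
      fix p assume "p \<in> J"
      from interval_family_bounds[OF J(1) this] have p: "a \<le> fst p" "fst p \<le> snd p" "snd p \<le> b" by auto
      have sub: "{fst p..snd p} \<subseteq> {a..b}" using p by auto
      have "integral {fst p..snd p} k - integral {fst p..snd p} ?r = integral {fst p..snd p} (?k n)"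
        using integral_diff[OF integrable_on_subinterval[OF int sub] integrable_on_subinterval[OF k_int[of n] sub]] by simp
      also have "\<dots> \<le> integral {fst p..snd p} (\<lambda>x. real n)"
        by (rule integral_le) (use integrable_on_subinterval[OF k_int[of n] sub] in auto)
      also have "\<dots> = real n * (snd p - fst p)" using p(2) by simp
      finally show "dist (F (snd p)) (F (fst p)) \<le> integral {fst p..snd p} ?r + real n * (snd p - fst p)"
        using le[OF p] by linarith
    qed
    also have "\<dots> = (\<Sum>p\<in>J. integral {fst p..snd p} ?r) + real n * (\<Sum>p\<in>J. snd p - fst p)"
      by (simp only: sum.distrib sum_distrib_left)
    also have "\<dots> \<le> integral {a..b} ?r + real n * \<delta>"
      using integral_superadditive_sum_le[OF J(1) \<open>a \<le> b\<close> r_int] J(2) by (intro add_mono mult_left_mono) auto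
    also have "real n * \<delta> \<le> \<epsilon> / 2"
    proof -
      have "real n * \<delta> \<le> m * \<delta>" using \<open>\<delta> > 0\<close> by (simp add: m_def)
      also have "\<dots> = \<epsilon> / 2" using \<open>m > 0\<close> by (simp add: \<delta>_def)
      finally show ?thesis .
    qed
    finally show ?thesis using r by linarith
  qed
  with \<open>\<delta> > 0\<close> show "\<exists>\<delta>>0. \<forall>J. interval_family a b J \<and> (\<Sum>p\<in>J. snd p - fst p) < \<delta> \<longrightarrow>
        (\<Sum>p\<in>J. dist (F (snd p)) (F (fst p))) < \<epsilon>" by blast
qed

text \<open>One-dimensional Sard: a vanishing derivative is the growth condition with density zero,
  so the image has outer measure at most \<open>e\<close> for every \<open>e\<close>.\<close>

lemma negligible_image_critical_points:
  fixes g :: "real \<Rightarrow> real"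
  assumes "a < b" "E \<subseteq> {a..b}" and g: "\<And>x. x \<in> E \<Longrightarrow> (g has_real_derivative 0) (at x within {a..b})"
  shows "negligible (g ` E)"
  unfolding negligible_outer_le
proof (intro allI impI)
  fix e :: real assume "e > 0"
  have "\<exists>T. g ` E \<subseteq> T \<and> T \<in> lmeasurable \<and> measure lebesgue T \<le> 2 * integral {a..b} (\<lambda>x. 0) + e"
  proof (rule measure_image_le_integral[OF assms(1,2) _ _ _ \<open>e > 0\<close>])
    fix x e :: real assume "x \<in> E" "e > 0"
    have "\<forall>e>0. \<exists>d>0. \<forall>y\<in>{a..b}. norm (y - x) < d \<longrightarrow> norm (g y - g x - 0 * (y - x)) \<le> e * norm (y - x)"
      using g[OF \<open>x \<in> E\<close>] unfolding has_field_derivative_def has_derivative_within_alt by blast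
    then show "\<exists>d>0. \<forall>y\<in>{a..b}. \<bar>y - x\<bar> < d \<longrightarrow> \<bar>g y - g x\<bar> \<le> (0 + e) * \<bar>y - x\<bar>"
      using \<open>e > 0\<close> by simp
  qed auto
  then show "\<exists>T. g ` E \<subseteq> T \<and> T \<in> lmeasurable \<and> measure lebesgue T \<le> e" by simp
qed

lemma dist_comp_le_integral:
  fixes f :: "real \<Rightarrow> 'm::metric_space" and g k :: "real \<Rightarrow> real"
  assumes f: "abs_cont_metric f c d" and g: "abs_cont_metric g a b" and img: "g ` {a..b} \<subseteq> {c..d}"
    and N: "negligible N" and int: "k integrable_on {a..b}" and nonneg: "\<And>x. 0 \<le> k x"
    and deriv: "\<And>x. x \<in> {a..b} - N \<Longrightarrow>
      (g has_real_derivative 0) (at x within {a..b}) \<or> has_metric_derivative (f \<circ> g) {a..b} x (k x)"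
    and st: "a \<le> s" "s \<le> t" "t \<le> b"
  shows "dist ((f \<circ> g) t) ((f \<circ> g) s) \<le> 2 * integral {s..t} k"
proof (cases "s < t")
  case False
  then show ?thesis using st by simp
next
  case True
  \<comment> \<open>The distance from \<open>f (g s)\<close> replaces points of the metric space by
    reals; it inherits absolute continuity from \<open>f\<close> by the reverse triangle inequality,
    and \<open>u s = 0\<close>.\<close>
  define w where "w z = dist (f z) (f (g s))" for z
  define u where "u y = w (g y)" for y
  have sub: "{s..t} \<subseteq> {a..b}" using st by auto
  have reverse_triangle: "\<bar>dist p r - dist q r\<bar> \<le> dist p q" for p q r :: 'm
    using abs_dist_diff_le[of p r q] by (simp add: dist_commute)
  have w: "abs_cont_metric w c d"
    by (rule abs_cont_metric_dist_le[OF f])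
      (simp add: w_def dist_real_def reverse_triangle)
  have u_diff: "\<bar>u y - u x\<bar> \<le> dist ((f \<circ> g) y) ((f \<circ> g) x)" for x y
    by (simp add: u_def w_def reverse_triangle)
  have u_cont: "continuous_on {s..t} u"
    unfolding u_def
    by (rule continuous_on_compose2[OF abs_cont_metric_imp_continuous_on[OF w]
        continuous_on_subset[OF abs_cont_metric_imp_continuous_on[OF g] sub]]) (use img sub in blast)
  \<comment> \<open>No metric derivative of \<open>f \<circ> g\<close> is given at points of
    \<open>C\<close>, so these count as exceptional along with those of \<open>N\<close>.\<close>
  define C where "C = {x \<in> {a..b}. (g has_real_derivative 0) (at x within {a..b})}"
  let ?E = "{s..t} - N - C" and ?Z = "({s..t} \<inter> N) \<union> ({s..t} \<inter> C)"
  have "negligible (g ` ({s..t} \<inter> N))"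
    by (rule abs_cont_negligible_image[OF g]) (use N sub in \<open>auto intro: negligible_subset\<close>)
  moreover have "negligible (g ` ({s..t} \<inter> C))"
  proof (rule negligible_image_critical_points)
    show "a < b" using st True by simp
  qed (use sub in \<open>auto simp: C_def\<close>)
  ultimately have "negligible (g ` ?Z)" by (simp add: image_Un)
  then have "negligible (w ` g ` ?Z)"
    by (rule abs_cont_negligible_image[OF w]) (use img sub in blast)
  then have uZ: "negligible (u ` ?Z)" by (simp add: image_image u_def)
  have bound: "u t \<le> 2 * integral {s..t} k + e" if "e > 0" for e
  proof -
    have "\<exists>T. u ` ?E \<subseteq> T \<and> T \<in> lmeasurable \<and> measure lebesgue T \<le> 2 * integral {s..t} k + e"
    proof (rule measure_image_le_integral[OF True _ integrable_on_subinterval[OF int sub] nonneg _ that])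
      fix x e' :: real assume x: "x \<in> ?E" and "e' > 0"
      then have "has_metric_derivative (f \<circ> g) {a..b} x (k x)"
        using deriv[of x] sub by (auto simp: C_def)
      from this[unfolded has_metric_derivative_iff, rule_format, OF \<open>e' > 0\<close>]
      obtain d where "d > 0" and d: "\<forall>y\<in>{a..b}. \<bar>y - x\<bar> < d \<longrightarrow>
        \<bar>dist ((f \<circ> g) y) ((f \<circ> g) x) - k x * \<bar>y - x\<bar>\<bar> \<le> e' * \<bar>y - x\<bar>" by blast
      have "\<bar>u y - u x\<bar> \<le> (k x + e') * \<bar>y - x\<bar>" if "y \<in> {s..t}" "\<bar>y - x\<bar> < d" for y
      proof -
        have "\<bar>dist ((f \<circ> g) y) ((f \<circ> g) x) - k x * \<bar>y - x\<bar>\<bar> \<le> e' * \<bar>y - x\<bar>"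
          using d that sub by blast
        then show ?thesis using u_diff[of y x] by (simp add: distrib_right)
      qed
      with \<open>d > 0\<close> show "\<exists>d>0. \<forall>y\<in>{s..t}. \<bar>y - x\<bar> < d \<longrightarrow> \<bar>u y - u x\<bar> \<le> (k x + e') * \<bar>y - x\<bar>"
        by blast
    qed auto
    then obtain T where T: "u ` ?E \<subseteq> T" "T \<in> lmeasurable" "measure lebesgue T \<le> 2 * integral {s..t} k + e"
      by blast
    \<comment> \<open>By connectedness the image fills the interval from \<open>u s = 0\<close> to
      \<open>u t\<close>, so \<open>u t\<close> is at most the measure of any measurable cover of
      the image.\<close>
    have "connected (u ` {s..t})" using u_cont by (intro connected_continuous_image) auto
    moreover have "u s \<in> u ` {s..t}" "u t \<in> u ` {s..t}" using True by auto
    ultimately have "{u s..u t} \<subseteq> u ` {s..t}" using connected_contains_Icc by blast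
    moreover have "u ` {s..t} \<subseteq> u ` ?E \<union> u ` ?Z" by blast
    ultimately have "{u s..u t} \<subseteq> T \<union> u ` ?Z" using T(1) by blast
    moreover have TZ: "T \<union> u ` ?Z \<in> lmeasurable"
      using T(2) negligible_imp_measurable[OF uZ] by (rule fmeasurable.Un)
    ultimately have "measure lebesgue {u s..u t} \<le> measure lebesgue (T \<union> u ` ?Z)"
      by (intro measure_mono_fmeasurable) auto
    also have "\<dots> = measure lebesgue T"
      using T(2) uZ by (intro measure_Un_null_set) (auto simp: negligible_iff_null_sets)
    finally have "measure lebesgue {u s..u t} \<le> 2 * integral {s..t} k + e" using T(3) by linarith
    moreover have "u s = 0" "0 \<le> u t" by (simp_all add: u_def w_def)
    ultimately show ?thesis by simp
  qed
  have "u t \<le> 2 * integral {s..t} k" using bound by (rule field_le_epsilon)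
  then show ?thesis by (simp add: u_def w_def)
qed

section \<open>Absolute continuity of the composition and integrability of \<open>h\<close>\<close>

text \<open>Off a null set \<open>h_value_at\<close> determines its value, so all admissible
  \<open>h\<close> agree almost everywhere with one function \<open>h0\<close>, and the equivalence
  does not depend on the choice among them.\<close>

theorem theorem3p16:
  fixes f :: "real \<Rightarrow> 'm::metric_space" and g :: "real \<Rightarrow> real" and a b c d :: real
  assumes "a \<le> b" and "c \<le> d"
    and "g ` {a..b} \<subseteq> {c..d}"
    and "abs_cont_metric f c d"
    and "abs_cont_metric g a b"
  shows "(\<exists>h. AE x in lebesgue. x \<in> {a..b} \<longrightarrow> h_value_at f g a b c d x (h x))
    \<and> (\<forall>h. (AE x in lebesgue. x \<in> {a..b} \<longrightarrow> h_value_at f g a b c d x (h x)) \<longrightarrow>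
          (abs_cont_metric (f \<circ> g) a b \<longleftrightarrow> integrable (lebesgue_on {a..b}) h))"
proof -
  have int_iff: "integrable (lebesgue_on {a..b}) h \<longleftrightarrow> h absolutely_integrable_on {a..b}" for h :: "real \<Rightarrow> real"
    by (simp add: integrable_restrict_space set_integrable_def)
  show ?thesis
  proof (cases "a < b")
    case False
    \<comment> \<open>On a single point every function is integrable, and only the empty family
      exists, so both sides of the equivalence hold.\<close>
    then have "a = b" using \<open>a \<le> b\<close> by simp
    have neg: "negligible {a..b}" using \<open>a = b\<close> by simp
    have "AE x in lebesgue. x \<in> {a..b} \<longrightarrow> h_value_at f g a b c d x 0"
      unfolding eventually_ae_filter_negligible using neg by blast
    moreover have "h absolutely_integrable_on {a..b}" for h :: "real \<Rightarrow> real"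
      by (rule absolutely_integrable_negligible[OF neg])
    moreover have "abs_cont_metric (f \<circ> g) a b"
    proof -
      have "F = {}" if "interval_family a b F" for F
        using interval_family_bounds[OF that] \<open>a = b\<close> by fastforce
      then show ?thesis
        unfolding abs_cont_metric_iff by (metis sum.empty zero_less_one)
    qed
    ultimately show ?thesis unfolding int_iff by (intro conjI exI[of _ "\<lambda>_. 0"]) simp_all
  next
    case True
    obtain \<psi> Ng where \<psi>_int: "\<psi> integrable_on {a..b}" and Ng: "negligible Ng"
      and \<psi>: "\<And>x. x \<in> {a..b} - Ng \<Longrightarrow> (g has_real_derivative \<psi> x) (at x within {a..b})"
      by (rule abs_cont_real_derivative_ae[OF assms(5)]) (rule that)
    obtain \<phi> Nf where \<phi>_nonneg: "\<And>y. 0 \<le> \<phi> y" and Nf: "negligible Nf"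
      and \<phi>: "\<And>y. y \<in> {c..d} - Nf \<Longrightarrow> has_metric_derivative f {c..d} y (\<phi> y)"
      by (rule abs_cont_metric_derivative_ae[OF assms(4)]) (rule that)
    \<comment> \<open>Removing the end points makes the good set empty when \<open>c = d\<close>, where metric derivatives are not unique.\<close>
    define Nf' where "Nf' = Nf \<union> {c, d}"
    define S where "S = {x \<in> {a..b} - Ng. \<psi> x \<noteq> 0}"
    \<comment> \<open>On \<open>S\<close> the derivative of \<open>g\<close> is invertible, so the
      preimage in \<open>S\<close> of a null set is null: almost every point of \<open>S\<close> is
      sent to where the metric derivative of \<open>f\<close> exists.\<close>
    have neg_vimage: "negligible {x \<in> S. g x \<in> Nf'}"
    proof (rule negligible_differentiable_vimage)
      show "negligible Nf'" using Nf by (simp add: Nf'_def negligible_Un)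
      show "inj ((*) (\<psi> x))" if "x \<in> S" for x using that by (auto simp: S_def inj_def)
      show "(g has_derivative (*) (\<psi> x)) (at x within S)" if "x \<in> S" for x
      proof (rule has_derivative_subset)
        show "(g has_derivative (*) (\<psi> x)) (at x within {a..b})"
          using \<psi>[of x] that by (simp add: S_def has_field_derivative_def)
      qed (auto simp: S_def)
    qed
    \<comment> \<open>The end points are removed so that the derivative within the interval is
      two-sided and hence unique.\<close>
    define N where "N = Ng \<union> {x \<in> S. g x \<in> Nf'} \<union> {a, b}"
    have N: "negligible N" unfolding N_def using Ng neg_vimage by (intro negligible_Un) auto
    define h0 where "h0 x = (if \<psi> x = 0 then 0 else \<phi> (g x) * \<psi> x)" for x
    have deriv: "(g has_real_derivative \<psi> x) (at x within {a..b})" if "x \<in> {a..b} - N" for x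
      using \<psi> that by (simp add: N_def)
    have md: "has_metric_derivative f {c..d} (g x) (\<phi> (g x))" "c < d" if "x \<in> {a..b} - N" "\<psi> x \<noteq> 0" for x
    proof -
      have "g x \<in> {c..d}" using that(1) assms(3) by blast
      then have "g x \<in> {c..d} - Nf'" using that by (auto simp: N_def S_def)
      then show "has_metric_derivative f {c..d} (g x) (\<phi> (g x))" "c < d"
        using \<phi>[of "g x"] by (auto simp: Nf'_def)
    qed
    have value_iff: "h_value_at f g a b c d x v \<longleftrightarrow> v = h0 x" if x: "x \<in> {a..b} - N" for x v
    proof -
      have ab: "a < x" "x < b" using x by (auto simp: N_def)
      have D: "D = \<psi> x" if "(g has_real_derivative D) (at x within {a..b})" for D
        using that deriv[OF x] unfolding at_within_Icc_at[OF ab] by (rule DERIV_unique)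
      have L: "L = \<phi> (g x)" if "has_metric_derivative f {c..d} (g x) L" "\<psi> x \<noteq> 0" for L
        by (rule has_metric_derivative_unique[OF that(1) md[OF x that(2)]]) (use x assms(3) in blast)
      show ?thesis
      proof
        assume "h_value_at f g a b c d x v"
        then obtain D where gD: "(g has_real_derivative D) (at x within {a..b})"
          and v: "if D = 0 then v = 0 else \<exists>L. has_metric_derivative f {c..d} (g x) L \<and> v = L * D"
          unfolding h_value_at_def by blast
        have D_eq: "D = \<psi> x" by (rule D[OF gD])
        show "v = h0 x"
        proof (cases "\<psi> x = 0")
          case True
          then show ?thesis using v by (simp add: D_eq h0_def)
        next
          case False
          then obtain L' where L': "has_metric_derivative f {c..d} (g x) L'" "v = L' * \<psi> x"
            using v by (auto simp: D_eq)
          then show ?thesis using L[OF L'(1) False] False by (simp add: h0_def)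
        qed
      next
        assume v: "v = h0 x"
        have "if \<psi> x = 0 then v = 0 else \<exists>L. has_metric_derivative f {c..d} (g x) L \<and> v = L * \<psi> x"
          using md(1)[OF x] by (auto simp: v h0_def)
        with deriv[OF x] show "h_value_at f g a b c d x v"
          unfolding h_value_at_def by blast
      qed
    qed
    have "AE x in lebesgue. x \<in> {a..b} \<longrightarrow> h_value_at f g a b c d x (h0 x)"
      unfolding eventually_ae_filter_negligible using N value_iff by blast
    moreover have "abs_cont_metric (f \<circ> g) a b \<longleftrightarrow> h absolutely_integrable_on {a..b}"
      if ae: "AE x in lebesgue. x \<in> {a..b} \<longrightarrow> h_value_at f g a b c d x (h x)" for h
    proof -
      obtain N2 where N2: "negligible N2" "{x. \<not> (x \<in> {a..b} \<longrightarrow> h_value_at f g a b c d x (h x))} \<subseteq> N2"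
        using ae unfolding eventually_ae_filter_negligible by blast
      define M where "M = N \<union> N2"
      have M: "negligible M" unfolding M_def using N N2(1) by (rule negligible_Un)
      have h: "h x = h0 x" "x \<in> {a..b} - N" if "x \<in> {a..b} - M" for x
        using value_iff[of x "h x"] N2(2) that by (auto simp: M_def)
      have md_comp: "has_metric_derivative (f \<circ> g) {a..b} x (\<phi> (g x) * \<bar>\<psi> x\<bar>)"
        if "x \<in> {a..b} - M" "\<psi> x \<noteq> 0" for x
        using has_metric_derivative_compose[OF md(1)[OF h(2)[OF that(1)] that(2)] deriv[OF h(2)[OF that(1)]] assms(3)] .
      show ?thesis
      proof
        assume "abs_cont_metric (f \<circ> g) a b"
        from abs_cont_metric_derivative_ae[OF this] obtain \<phi>F NF where \<phi>F_nonneg: "\<And>x. 0 \<le> \<phi>F x" and \<phi>F_int: "\<phi>F integrable_on {a..b}" and NF: "negligible NF"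
          and \<phi>F: "\<And>x. x \<in> {a..b} - NF \<Longrightarrow> has_metric_derivative (f \<circ> g) {a..b} x (\<phi>F x)"
          by blast
        have [measurable]: "\<psi> \<in> borel_measurable (lebesgue_on {a..b})" "\<phi>F \<in> borel_measurable (lebesgue_on {a..b})"
          by (rule integrable_imp_measurable, fact)+
        \<comment> \<open>Measurability is taken from \<open>\<psi>\<close> and
          \<open>\<phi>F\<close>, as none is at hand for \<open>\<phi> \<circ> g\<close>.\<close>
        have "(\<lambda>x. sgn (\<psi> x) * \<phi>F x) absolutely_integrable_on {a..b}"
        proof (rule measurable_bounded_by_integrable_imp_absolutely_integrable[OF _ _ \<phi>F_int])
          show "norm (sgn (\<psi> x) * \<phi>F x) \<le> \<phi>F x" for x
            using \<phi>F_nonneg[of x] by (simp add: abs_mult sgn_real_def)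
        qed auto
        then show "h absolutely_integrable_on {a..b}"
        proof (rule absolutely_integrable_spike)
          show "negligible (M \<union> NF)" using M NF by (rule negligible_Un)
          fix x assume x: "x \<in> {a..b} - (M \<union> NF)"
          \<comment> \<open>Two metric derivatives of \<open>f \<circ> g\<close> at the same point
            coincide. Where \<open>\<psi> x = 0\<close> no such comparison is made, since both sides
            of the final equation vanish.\<close>
          have "\<phi>F x = \<phi> (g x) * \<bar>\<psi> x\<bar>" if "\<psi> x \<noteq> 0"
            by (rule has_metric_derivative_unique[OF \<phi>F md_comp True]) (use x that in auto)
          then show "h x = sgn (\<psi> x) * \<phi>F x"
            using h(1)[of x] x by (auto simp: h0_def sgn_real_def)
        qed
      next
        assume "h absolutely_integrable_on {a..b}"
        then have int: "(\<lambda>x. \<bar>h x\<bar>) integrable_on {a..b}" by (simp add: absolutely_integrable_on_def)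
        have le: "dist ((f \<circ> g) t) ((f \<circ> g) s) \<le> 2 * integral {s..t} (\<lambda>x. \<bar>h x\<bar>)"
          if "a \<le> s" "s \<le> t" "t \<le> b" for s t
        proof (rule dist_comp_le_integral[OF assms(4,5,3) M int _ _ that])
          fix x assume x: "x \<in> {a..b} - M"
          \<comment> \<open>Where \<open>\<psi> x = 0\<close>, the metric derivative of
            \<open>f \<circ> g\<close> may not exist, and the first alternative is taken.\<close>
          show "(g has_real_derivative 0) (at x within {a..b}) \<or> has_metric_derivative (f \<circ> g) {a..b} x \<bar>h x\<bar>"
          proof (cases "\<psi> x = 0")
            case True
            then show ?thesis using deriv[OF h(2)[OF x]] by simp
          next
            case False
            then show ?thesis
              using md_comp[OF x False] h(1)[OF x] \<phi>_nonneg[of "g x"] by (simp add: h0_def abs_mult)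
          qed
        qed simp
        show "abs_cont_metric (f \<circ> g) a b"
        \<comment> \<open>The factor 2 in the estimate is absorbed into the integrable
          majorant.\<close>
        proof (rule abs_cont_metric_if_dist_le_integral[of "\<lambda>x. 2 * \<bar>h x\<bar>"])
          show "(\<lambda>x. 2 * \<bar>h x\<bar>) integrable_on {a..b}" using integrable_cmul[OF int, of 2] by simp
          show "dist ((f \<circ> g) t) ((f \<circ> g) s) \<le> integral {s..t} (\<lambda>x. 2 * \<bar>h x\<bar>)"
            if "a \<le> s" "s \<le> t" "t \<le> b" for s t
            using le[OF that] by simp
        qed (use True in auto)
      qed
    qed
    ultimately show ?thesis unfolding int_iff by blast
  qed
qed

end
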